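(* Let $N\geq2$, $1\leq d<N$ be integers, $0<p<q\leq\infty$ and $s>\sigma_p$. Let $\chi:=\frac{qp}{q-p}$ if $q<\infty$ and $\chi:=p$ if $q=\infty$. Let $\Psi$ be an admissible function satisfying $$\sum_{j\geq0}\Psi(2^{-j})^\chi<\infty.$$ Suppose that $f\in B_{p,q}^s(\mathbb{R}^N)$. Then $$f(\cdot,y)\in B_{p,q}^{(s,\Psi)}(\mathbb{R}^d)\qquad\text{for a.e. } y\in\mathbb{R}^{N-d}.$$
   Context: $\sigma_p:=N\left(\frac1p-1\right)_+$ with $x_+=\max\{0,x\}$. Points of $\mathbb{R}^N$ are written $(x,y)$ with $x\in\mathbb{R}^d$, $y\in\mathbb{R}^{N-d}$, and $f(\cdot,y)$ is the function $x\mapsto f(x,y)$ on $\mathbb{R}^d$. A real function $\Psi$ on $(0,1]$ is called admissible if it is positive and monotone on $(0,1]$ and $\Psi(2^{-j})\sim\Psi(2^{-2j})$ for all $j\in\mathbb{N}=\{0,1,2,\dots\}$, i.e. there are constants $0<c\le C$ with $c\,\Psi(2^{-2j})\leq\Psi(2^{-j})\leq C\,\Psi(2^{-2j})$ for all $j$. For $M\in\{1,2,\dots\}$ and $h\in\mathbb{R}^n$, $\Delta_h^Mf(x)=\sum_{j=0}^M(-1)^{M-j}\binom{M}{j}f(x+hj)$. Let $n\geq1$, $0<p,q\leq\infty$, $s>n(\frac1p-1)_+$ with $s>0$, and let $M>s$ be an integer. The Besov space $B_{p,q}^s(\mathbb{R}^n)$ is the set of all $f\in L^p(\mathbb{R}^n)$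 with $\left(\int_{|h|\leq1}\|\Delta_h^Mf\|_{L^p(\mathbb{R}^n)}^q\frac{\mathrm{d}h}{|h|^{n+sq}}\right)^{1/q}<\infty$ (for $q=\infty$: $\sup_{0<|h|\leq1}|h|^{-s}\|\Delta_h^Mf\|_{L^p(\mathbb{R}^n)}<\infty$). For $\Psi$ admissible, the Besov space of generalized smoothness $B_{p,q}^{(s,\Psi)}(\mathbb{R}^n)$ is the set of all $f\in L^p(\mathbb{R}^n)$ with $$\left(\int_0^1\sup_{|h|\leq t}\|\Delta_h^Mf\|_{L^p(\mathbb{R}^n)}^q\frac{\Psi(t)^q}{t^{1+sq}}\,\mathrm{d}t\right)^{1/q}<\infty$$ (for $q=\infty$: $\sup_{0<t\leq1}t^{-s}\Psi(t)\sup_{|h|\leq t}\|\Delta_h^Mf\|_{L^p(\mathbb{R}^n)}<\infty$). Different choices of $M>s$ give the same spaces. *)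

theory Defs
  imports "HOL-Analysis.Analysis" "HOL-Probability.Essential_Supremum"
begin

text \<open>
  Integrability exponents \<open>p, q \<in> (0, \<infinity>]\<close> are elements of \<^typ>\<open>ennreal\<close>. Elements of the function
  spaces are represented by Lebesgue measurable complex-valued functions; membership depends only
  on the class of the function up to null sets.
\<close>

text \<open>Only meant for exponents \<open>a > 0\<close>.\<close>

definition epowr :: "ennreal \<Rightarrow> real \<Rightarrow> ennreal" where
  "epowr x a = (if x = \<infinity> then \<infinity> else ennreal (enn2real x powr a))"

definition Lp_norm :: "ennreal \<Rightarrow> ('a::euclidean_space \<Rightarrow> complex) \<Rightarrow> ennreal" where
  "Lp_norm p f =
     (if p = \<infinity> then esssup lebesgue (\<lambda>x. ennreal (norm (f x)))
      else epowr (\<integral>\<^sup>+ x. ennreal (norm (f x) powr enn2real p) \<partial>lebesgue) (1 / enn2real p))"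

definition Lp_space :: "ennreal \<Rightarrow> ('a::euclidean_space \<Rightarrow> complex) set" where
  "Lp_space p = {f \<in> borel_measurable lebesgue. Lp_norm p f < \<infinity>}"

definition fdiff :: "nat \<Rightarrow> 'a::euclidean_space \<Rightarrow> ('a \<Rightarrow> complex) \<Rightarrow> 'a \<Rightarrow> complex" where
  "fdiff M h f x = (\<Sum>j\<le>M. (-1) ^ (M - j) * of_nat (M choose j) * f (x + real j *\<^sub>R h))"

definition besov_seminorm ::
    "nat \<Rightarrow> real \<Rightarrow> ennreal \<Rightarrow> ennreal \<Rightarrow> ('a::euclidean_space \<Rightarrow> complex) \<Rightarrow> ennreal" where
  "besov_seminorm M s p q f =
     (if q = \<infinity> then
        (SUP h \<in> {h. 0 < norm h \<and> norm h \<le> 1}. ennreal (norm h powr (- s)) * Lp_norm p (fdiff M h f))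
      else
        epowr (\<integral>\<^sup>+ h \<in> {h. norm h \<le> 1}.
                 (epowr (Lp_norm p (fdiff M h f)) (enn2real q)
                   / ennreal (norm h powr (real DIM('a) + s * enn2real q))) \<partial>lebesgue)
              (1 / enn2real q))"

definition besov_space ::
    "nat \<Rightarrow> real \<Rightarrow> ennreal \<Rightarrow> ennreal \<Rightarrow> ('a::euclidean_space \<Rightarrow> complex) set" where
  "besov_space M s p q = {f \<in> Lp_space p. besov_seminorm M s p q f < \<infinity>}"

definition admissible :: "(real \<Rightarrow> real) \<Rightarrow> bool" where
  "admissible \<Psi> \<longleftrightarrow>
     (\<forall>t\<in>{0<..1}. \<Psi> t > 0) \<and>
     (mono_on {0<..1} \<Psi> \<or> antimono_on {0<..1} \<Psi>) \<and>
     (\<exists>c C. 0 < c \<and> c \<le> C \<and>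
        (\<forall>j::nat. c * \<Psi> (2 powr (- (2 * real j))) \<le> \<Psi> (2 powr (- real j)) \<and>
                  \<Psi> (2 powr (- real j)) \<le> C * \<Psi> (2 powr (- (2 * real j)))))"

definition gen_besov_seminorm ::
    "nat \<Rightarrow> real \<Rightarrow> (real \<Rightarrow> real) \<Rightarrow> ennreal \<Rightarrow> ennreal \<Rightarrow> ('a::euclidean_space \<Rightarrow> complex) \<Rightarrow> ennreal" where
  "gen_besov_seminorm M s \<Psi> p q f =
     (if q = \<infinity> then
        (SUP t \<in> {0<..1}. ennreal (t powr (- s) * \<Psi> t) *
           (SUP h \<in> {h. norm h \<le> t}. Lp_norm p (fdiff M h f)))
      else
        epowr (\<integral>\<^sup>+ t \<in> {0<..1}.
                 ((SUP h \<in> {h. norm h \<le> t}. epowr (Lp_norm p (fdiff M h f)) (enn2real q))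
                   * ennreal (\<Psi> t powr enn2real q / t powr (1 + s * enn2real q))) \<partial>lebesgue)
              (1 / enn2real q))"

definition gen_besov_space ::
    "nat \<Rightarrow> real \<Rightarrow> (real \<Rightarrow> real) \<Rightarrow> ennreal \<Rightarrow> ennreal \<Rightarrow> ('a::euclidean_space \<Rightarrow> complex) set" where
  "gen_besov_space M s \<Psi> p q = {f \<in> Lp_space p. gen_besov_seminorm M s \<Psi> p q f < \<infinity>}"

text \<open>For \<open>p = \<infinity>\<close> the convention \<open>1 / 0 = 0\<close> yields the correct value 0.\<close>

definition sigma_index :: "nat \<Rightarrow> ennreal \<Rightarrow> real" where
  "sigma_index N p = real N * max 0 (1 / enn2real p - 1)"

text \<open>Only meant for \<open>0 < p < q\<close>, so that \<open>p\<close> is finite.\<close>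

definition chi_index :: "ennreal \<Rightarrow> ennreal \<Rightarrow> real" where
  "chi_index p q =
     (if q = \<infinity> then enn2real p else enn2real q * enn2real p / (enn2real q - enn2real p))"

end

theory Submission
  imports Defs
begin

text \<open>
  Fix \<open>p\<close> and let \<open>W(t)\<close> be the supremum over \<open>norm h \<le> t\<close> of the integral of
  \<open>norm (fdiff K h f x) powr p\<close>, and \<open>b j = 2 powr (j * s * p) * W (2 powr - j)\<close>. Membership of \<open>f\<close>
  in the Besov space means that the sequence \<open>b\<close> lies in \<open>\<ell>\<^sup>r\<close> with \<open>r = q / p > 1\<close>
  (\<open>suminf_dyadic_mod_finite\<close>, \<open>SUP_dyadic_mod_finite\<close>). The condition on \<open>\<Psi>\<close> says that the
  sequence \<open>\<Psi> (2 powr - j) powr p\<close> lies in \<open>\<ell>\<^sup>r'\<close> with the dual exponent \<open>r' = r / (r - 1)\<close>, because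
  \<open>chi_index p q = p * r'\<close>. Hence the sum
  of \<open>\<Psi> (2 powr - j) powr p * b j\<close> is finite. This is a statement in \<open>\<ell>\<^sup>1\<close>, so it commutes
  with integration in \<open>y\<close>: as a multiple of \<open>b j\<close> dominates the integral over \<open>y\<close> of the same quantity for the slice
  \<open>f (\<cdot>, y)\<close>, the weighted sum is finite for almost every slice (\<open>AE_slice_suminf_finite\<close>). Passing
  from \<open>\<ell>\<^sup>1\<close> to \<open>\<ell>\<^sup>r\<close> gives the generalized seminorm of the slice (\<open>gen_besov_seminorm_finite\<close>).

  The obstacle is that for a slice the supremum over the step stands inside the integral over \<open>y\<close>,
  whereas the Besov seminorm of \<open>f\<close> only controls averages over all steps in the product space. Both gaps are
  closed by one algebraic identity, \<open>fdiff_two_steps\<close>. It writes a difference with step \<open>h\<close> in terms of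
  differences with steps \<open>k u\<close> and \<open>h + k u\<close>, where \<open>u\<close> is arbitrary. Averaging over \<open>u\<close> in a ball
  bounds the supremum over steps by an average over steps (\<open>epowr_pow_int_fdiff_average\<close>). For slices the
  average can be integrated in \<open>y\<close> by Tonelli's theorem, which leads to steps parallel to the first
  factor; on the product space the same bound, applied with the power \<open>r\<close>, estimates these steps by the seminorm.

  It remains to pass from differences of order \<open>M\<close> to order \<open>K\<close>. Raising the order is trivial, and
  lowering it is an inequality of Marchaud type: modulo differences of order \<open>K + 1\<close>, doubling the step
  multiplies a difference of order \<open>K\<close> by \<open>2 ^ K\<close>. As \<open>K > s\<close>, this is a contracting recursion for
  the sequence \<open>b\<close> (\<open>dyadic_mod_marchaud\<close>).

  The cases \<open>p < 1\<close> and \<open>p \<ge> 1\<close> are treated alike: in place of the triangle inequality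
  for norms stands the pointwise bound \<open>(a + b) powr p \<le> l * a powr p + C * b powr p\<close>, valid for every \<open>l > 1\<close>.
\<close>

section \<open>Powers of extended nonnegative reals\<close>

lemma epowr_ennreal: "0 \<le> x \<Longrightarrow> epowr (ennreal x) a = ennreal (x powr a)"
  by (simp add: epowr_def)

lemma epowr_top [simp]: "epowr \<infinity> a = \<infinity>" "epowr top a = top"
  by (simp_all add: epowr_def)

lemma epowr_0 [simp]: "epowr 0 a = 0"
  by (simp add: epowr_def)

lemma epowr_one [simp]: "epowr x 1 = x"
  by (cases x) (simp_all add: epowr_def)

lemma epowr_less_top_iff [simp]: "epowr x a < top \<longleftrightarrow> x < top"
  by (simp add: epowr_def less_top)

lemma epowr_mono: "x \<le> y \<Longrightarrow> 0 \<le> a \<Longrightarrow> epowr x a \<le> epowr y a"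
  by (auto simp: epowr_def top_unique less_top intro!: ennreal_leI powr_mono2 enn2real_mono)

lemma ennreal_cmult_cmult:
  "0 \<le> a \<Longrightarrow> 0 \<le> b \<Longrightarrow> ennreal a * (ennreal b * x) = ennreal (a * b) * x"
  by (simp add: ennreal_mult mult.assoc)

lemma epowr_cmult:
  assumes "0 < c"
  shows "epowr (ennreal c * x) a = ennreal (c powr a) * epowr x a"
proof (cases x)
  case (real r)
  then show ?thesis
    using assms by (simp add: epowr_ennreal powr_mult flip: ennreal_mult)
next
  case top
  then show ?thesis
    using assms by (simp add: ennreal_mult_top)
qed

lemma epowr_epowr: "epowr (epowr x a) b = epowr x (a * b)"
  by (cases x) (simp_all add: epowr_ennreal powr_powr)

lemma borel_measurable_epowr [measurable]: "(\<lambda>x. epowr x a) \<in> borel_measurable borel"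
  unfolding epowr_def by measurable

lemma epowr_SUP_le:
  assumes "\<And>i. i \<in> I \<Longrightarrow> epowr (f i) r \<le> B" and "0 < r"
  shows "epowr (SUP i\<in>I. f i) r \<le> B"
proof -
  have "f i \<le> epowr B (1 / r)" if "i \<in> I" for i
  proof -
    have "f i = epowr (epowr (f i) r) (1 / r)"
      using assms(2) by (simp add: epowr_epowr)
    also have "\<dots> \<le> epowr B (1 / r)"
      using assms that by (intro epowr_mono) auto
    finally show ?thesis .
  qed
  then have "epowr (SUP i\<in>I. f i) r \<le> epowr (epowr B (1 / r)) r"
    using assms(2) by (intro epowr_mono SUP_least) auto
  then show ?thesis
    using assms(2) by (simp add: epowr_epowr)
qed

text \<open>
  For a sequence \<open>z\<close> with sum \<open>S\<close> this is the inclusion of \<open>\<ell>\<^sup>1\<close> in \<open>\<ell>\<^sup>r\<close>.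
\<close>

lemma epowr_le_mult:
  assumes "1 < r" and "z \<le> S"
  shows "epowr z r \<le> epowr S (r - 1) * z"
proof (cases z)
  case (real x)
  then have "epowr z r = ennreal (x powr (r - 1) * x powr 1)"
    by (simp only: epowr_ennreal powr_add[symmetric] diff_add_cancel)
  also have "\<dots> = epowr z (r - 1) * z"
    using real by (simp add: epowr_ennreal ennreal_mult)
  also have "\<dots> \<le> epowr S (r - 1) * z"
    using assms by (intro mult_right_mono epowr_mono) auto
  finally show ?thesis .
next
  case top
  with assms show ?thesis by (simp add: top_unique)
qed

text \<open>
  Bounding every term by the largest one loses only a power of the number of terms, for all \<open>p > 0\<close> alike.
\<close>

lemma powr_sum_le:
  fixes a :: "'i \<Rightarrow> real"
  assumes "finite I" and "\<And>i. i \<in> I \<Longrightarrow> 0 \<le> a i" and "0 < p"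
  shows "(\<Sum>i\<in>I. a i) powr p \<le> real (card I) powr p * (\<Sum>i\<in>I. a i powr p)"
proof (cases "I = {}")
  case False
  then obtain k where k: "k \<in> I" "\<And>i. i \<in> I \<Longrightarrow> a i \<le> a k"
    using assms(1) by (metis obtains_MAX Max_ge finite_imageI imageI)
  have "(\<Sum>i\<in>I. a i) powr p \<le> (real (card I) * a k) powr p"
    using k assms by (intro powr_mono2 sum_nonneg sum_bounded_above) auto
  also have "\<dots> = real (card I) powr p * a k powr p"
    using k assms by (simp add: powr_mult)
  also have "\<dots> \<le> real (card I) powr p * (\<Sum>i\<in>I. a i powr p)"
    using k assms by (intro mult_left_mono member_le_sum) auto
  finally show ?thesis .
qed simp

lemma epowr_sum_le:
  assumes "finite I" and "0 < r"
  shows "epowr (\<Sum>i\<in>I. a i) r \<le> ennreal (real (card I) powr r) * (\<Sum>i\<in>I. epowr (a i) r)"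
proof (cases "\<exists>i\<in>I. a i = \<infinity>")
  case True
  then have "card I > 0" and "(\<Sum>i\<in>I. epowr (a i) r) = top"
    using assms by (auto simp: card_gt_0_iff intro!: bexI[where P = "\<lambda>i. epowr (a i) r = top"])
  then show ?thesis
    by (simp add: ennreal_mult_top)
next
  case False
  define b where "b i = enn2real (a i)" for i
  have a: "a i = ennreal (b i)" if "i \<in> I" for i
    using False that by (simp add: b_def less_top)
  have b: "b i \<ge> 0" for i by (simp add: b_def)
  have "epowr (\<Sum>i\<in>I. a i) r = ennreal ((\<Sum>i\<in>I. b i) powr r)"
    using b by (simp add: a sum_nonneg epowr_ennreal cong: sum.cong)
  also have "\<dots> \<le> ennreal (real (card I) powr r * (\<Sum>i\<in>I. b i powr r))"
    using b assms by (intro ennreal_leI powr_sum_le) auto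
  also have "\<dots> = ennreal (real (card I) powr r) * (\<Sum>i\<in>I. epowr (a i) r)"
    using b by (simp add: a ennreal_mult sum_nonneg epowr_ennreal cong: sum.cong)
  finally show ?thesis .
qed

text \<open>
  If \<open>b \<le> d * a\<close> then \<open>(a + b) powr p \<le> (1 + d) powr p * a powr p\<close>, and otherwise
  \<open>(a + b) powr p \<le> (1 + 1 / d) powr p * b powr p\<close>. The leading factor \<open>l\<close> may be taken as close to
  \<open>1\<close> as desired; a fixed factor would spoil the contraction in the change of order below.
\<close>

lemma powr_add_le_eps:
  fixes p l :: real
  assumes "0 < p" and "1 < l"
  obtains C where "0 < C"
    and "\<And>a b. 0 \<le> a \<Longrightarrow> 0 \<le> b \<Longrightarrow> (a + b) powr p \<le> l * a powr p + C * b powr p"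
proof -
  define d where "d = l powr (1 / p) - 1"
  have d: "0 < d"
    using assms by (simp add: d_def)
  have dp: "(1 + d) powr p = l"
    using assms by (simp add: d_def powr_powr)
  have "(a + b) powr p \<le> l * a powr p + (1 + 1 / d) powr p * b powr p"
    if ab: "0 \<le> a" "0 \<le> b" for a b :: real
  proof (cases "b \<le> d * a")
    case True
    then have "(a + b) powr p \<le> ((1 + d) * a) powr p"
      using assms ab by (intro powr_mono2) (auto simp: algebra_simps)
    also have "\<dots> = l * a powr p"
      using ab d dp by (simp add: powr_mult)
    finally show ?thesis
      by (smt (verit) mult_nonneg_nonneg powr_ge_zero)
  next
    case False
    then have "a \<le> b / d"
      using d by (simp add: field_simps)
    then have "(a + b) powr p \<le> ((1 + 1 / d) * b) powr p"
      using assms ab by (intro powr_mono2) (auto simp: algebra_simps)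
    also have "\<dots> = (1 + 1 / d) powr p * b powr p"
      using ab d by (simp add: powr_mult)
    finally show ?thesis
      using assms by (smt (verit) mult_nonneg_nonneg powr_ge_zero)
  qed
  moreover have "0 < 1 + 1 / d"
    using d by (simp add: add_pos_pos)
  then have "0 < (1 + 1 / d) powr p"
    by simp
  ultimately show ?thesis
    using that by blast
qed

lemma epowr_add_le_eps:
  fixes r l :: real
  assumes "0 < r" and "1 < l"
  obtains C where "0 < C"
    and "\<And>a b. epowr (a + b) r \<le> ennreal l * epowr a r + ennreal C * epowr b r"
proof -
  obtain C where C: "0 < C"
    "\<And>a b. 0 \<le> a \<Longrightarrow> 0 \<le> b \<Longrightarrow> (a + b) powr r \<le> l * a powr r + C * b powr r"
    using powr_add_le_eps[OF assms] by metis
  have "epowr (a + b) r \<le> ennreal l * epowr a r + ennreal C * epowr b r" for a b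
  proof (cases "a = \<infinity> \<or> b = \<infinity>")
    case True
    then show ?thesis
      using C(1) assms by (auto simp: ennreal_mult_top)
  next
    case False
    then obtain x y where "a = ennreal x" "0 \<le> x" "b = ennreal y" "0 \<le> y"
      by (metis ennreal_cases infinity_ennreal_def)
    then show ?thesis
      using C assms by (simp add: epowr_ennreal flip: ennreal_plus ennreal_mult) 
  qed
  with C(1) that show ?thesis by blast
qed

section \<open>Polynomials in a shift\<close>

text \<open>
  The value at the translation by \<open>h\<close> of the polynomial \<open>c\<close>. Identities between difference operators with
  parallel steps become polynomial identities.
\<close>

definition shift_poly :: "complex poly \<Rightarrow> 'a::real_vector \<Rightarrow> ('a \<Rightarrow> complex) \<Rightarrow> 'a \<Rightarrow> complex" where
  "shift_poly c h g x = (\<Sum>i\<le>degree c. coeff c i * g (x + real i *\<^sub>R h))"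

lemma shift_poly_0 [simp]: "shift_poly 0 h g x = 0"
  by (simp add: shift_poly_def)

lemma shift_poly_pCons:
  "shift_poly (pCons a c) h g x = a * g x + shift_poly c h g (x + h)"
proof (cases "c = 0")
  case True
  then show ?thesis by (simp add: shift_poly_def)
next
  case False
  have "(\<Sum>i\<le>Suc (degree c). coeff (pCons a c) i * g (x + real i *\<^sub>R h))
      = a * g x + (\<Sum>i\<le>degree c. coeff c i * g (x + real (Suc i) *\<^sub>R h))"
    by (subst sum.atMost_Suc_shift) simp
  also have "(\<lambda>i. g (x + real (Suc i) *\<^sub>R h)) = (\<lambda>i. g (x + h + real i *\<^sub>R h))"
    by (simp add: scaleR_add_left algebra_simps)
  finally show ?thesis
    using False by (simp add: shift_poly_def)
qed

lemma shift_poly_add: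
  "shift_poly (c + d) h g x = shift_poly c h g x + shift_poly d h g x"
  by (induction c d arbitrary: x rule: poly_induct2) (simp_all add: shift_poly_pCons algebra_simps)

lemma shift_poly_smult: "shift_poly (smult a c) h g x = a * shift_poly c h g x"
  by (induction c arbitrary: x) (simp_all add: shift_poly_pCons algebra_simps)

lemma shift_poly_mult: "shift_poly (c * d) h g x = shift_poly c h (shift_poly d h g) x"
  by (induction c arbitrary: x)
    (simp_all add: shift_poly_pCons shift_poly_add shift_poly_smult)

lemma shift_poly_monom: "shift_poly (monom 1 n) h g x = g (x + real n *\<^sub>R h)"
  by (simp add: shift_poly_def degree_monom_eq sum.delta if_distrib[of "\<lambda>a. a * _"] cong: if_cong)

lemma shift_poly_pcompose_monom:
  "shift_poly (pcompose c (monom 1 n)) h g x = shift_poly c (real n *\<^sub>R h) g x"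
proof (induction c arbitrary: x)
  case 0
  then show ?case by simp
next
  case (pCons a c)
  have "shift_poly (pcompose (pCons a c) (monom 1 n)) h g x
      = a * g x + shift_poly (monom 1 n) h (shift_poly (pcompose c (monom 1 n)) h g) x"
    by (simp add: pcompose_pCons shift_poly_add shift_poly_pCons shift_poly_mult)
  also have "\<dots> = shift_poly (pCons a c) (real n *\<^sub>R h) g x"
    by (simp only: shift_poly_monom pCons shift_poly_pCons)
  finally show ?case .
qed

lemma pcompose_power: "pcompose (c ^ n) d = pcompose c d ^ n"
  for c d :: "'a::comm_ring_1 poly"
  by (induction n) (simp_all add: pcompose_mult pcompose_1)

lemma fdiff_eq_shift_poly: "fdiff M h g = shift_poly ([:-1, 1:] ^ M) h g"
  unfolding fdiff_def shift_poly_def degree_linear_power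
  by (intro ext sum.cong) (auto simp: coeff_linear_poly_power)

lemma fdiff_add_order: "fdiff (M + n) h g = shift_poly ([:-1, 1:] ^ n) h (fdiff M h g)"
  by (rule ext) (simp add: fdiff_eq_shift_poly power_add shift_poly_mult[symmetric] mult.commute)

lemma fdiff_dilate:
  "fdiff M (real n *\<^sub>R h) g = shift_poly (pcompose ([:-1, 1:] ^ M) (monom 1 n)) h g"
  by (rule ext) (simp add: fdiff_eq_shift_poly shift_poly_pcompose_monom)

text \<open>
  \<open>X - 1\<close> divides \<open>X ^ n - 1\<close>.
\<close>

lemma fdiff_dilate_factor:
  "\<exists>c. \<forall>(h::'a::euclidean_space) g. fdiff M (real n *\<^sub>R h) g = shift_poly c h (fdiff M h g)"
proof -
  have "poly (monom 1 n - 1 :: complex poly) 1 = 0"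
    by (simp add: poly_monom)
  then have "[:-1, 1:] dvd (monom 1 n - 1 :: complex poly)"
    using poly_eq_0_iff_dvd[of "monom 1 n - 1 :: complex poly" 1] by simp
  then obtain S where S: "monom 1 n - 1 = [:-1, 1:] * (S :: complex poly)"
    by (auto simp: dvd_def)
  have "pcompose [:-1, 1:] (monom 1 n) = (monom 1 n - 1 :: complex poly)"
    by (simp add: pcompose_pCons one_pCons)
  then have "pcompose ([:-1, 1:] ^ M) (monom 1 n) = S ^ M * ([:-1, 1:] ^ M :: complex poly)"
    by (simp only: pcompose_power S power_mult_distrib mult.commute)
  then have "fdiff M (real n *\<^sub>R h) g = shift_poly (S ^ M) h (fdiff M h g)" for h :: 'a and g
    by (intro ext) (simp only: fdiff_dilate shift_poly_mult fdiff_eq_shift_poly[of M h])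
  then show ?thesis by blast
qed

text \<open>
  \<open>X ^ 2 - 1 = (X + 1) * (X - 1)\<close>, and \<open>(X + 1) ^ M\<close> is congruent to \<open>2 ^ M\<close> modulo \<open>X - 1\<close>.
\<close>

lemma fdiff_double:
  "\<exists>c. \<forall>(h::'a::euclidean_space) g x.
     fdiff M (2 *\<^sub>R h) g x = 2 ^ M * fdiff M h g x + shift_poly c h (fdiff (Suc M) h g) x"
proof -
  let ?D = "[:-1, 1:] :: complex poly"
  have "poly ([:1, 1:] ^ M - [:2 ^ M:] :: complex poly) 1 = 0"
    by (simp add: poly_power)
  then have "?D dvd [:1, 1:] ^ M - [:2 ^ M:]"
    using poly_eq_0_iff_dvd[of "[:1, 1:] ^ M - [:2 ^ M:] :: complex poly" 1] by simp
  then obtain R where R: "[:1, 1:] ^ M - [:2 ^ M:] = ?D * R"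
    by (auto simp: dvd_def)
  have "pcompose ?D (monom 1 2) = [:1, 1:] * ?D"
    by (simp add: pcompose_pCons monom_altdef numeral_2_eq_2)
  then have "pcompose (?D ^ M) (monom 1 2) = [:1, 1:] ^ M * ?D ^ M"
    by (simp only: pcompose_power power_mult_distrib)
  also have "[:1, 1:] ^ M = [:2 ^ M:] + ?D * R"
    using R by (simp add: algebra_simps)
  also have "([:2 ^ M:] + ?D * R) * ?D ^ M = smult (2 ^ M) (?D ^ M) + R * ?D ^ Suc M"
    by (simp add: algebra_simps)
  finally have *: "pcompose (?D ^ M) (monom 1 2) = smult (2 ^ M) (?D ^ M) + R * ?D ^ Suc M" .
  have "fdiff M (2 *\<^sub>R h) g x = 2 ^ M * fdiff M h g x + shift_poly R h (fdiff (Suc M) h g) x"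
    for h :: 'a and g x
    using fdiff_dilate[of M 2 h g]
    by (simp only: * shift_poly_add shift_poly_smult shift_poly_mult fdiff_eq_shift_poly
        of_nat_numeral)
  then show ?thesis by blast
qed

lemma fdiff_zero: "M \<noteq> 0 \<Longrightarrow> fdiff M 0 g x = 0"
  unfolding fdiff_eq_shift_poly
  by (simp add: shift_poly_def poly_altdef[symmetric, of _ 1, simplified] flip: sum_distrib_right)

text \<open>
  Expanding the differences with steps \<open>h + k u\<close> gives the double sum of \<open>f (x + j h + j k u)\<close> with
  alternating binomial weights in \<open>j\<close> and \<open>k\<close>. Summing over \<open>k\<close> first turns it into a sum of differences
  with steps \<open>j u\<close>. The term with index \<open>0\<close> is the difference with step \<open>h\<close> on one side, and on the
  other side a difference with step \<open>0\<close>, which vanishes.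
\<close>

lemma fdiff_two_steps:
  fixes h u :: "'a::euclidean_space"
  assumes "M \<noteq> 0"
  shows "fdiff M h g x = (\<Sum>k=1..M. (-1) ^ k * of_nat (M choose k) *
           (fdiff M (real k *\<^sub>R u) g (x + real k *\<^sub>R h) - fdiff M (h + real k *\<^sub>R u) g x))"
proof -
  define a where "a k = ((-1) ^ k * of_nat (M choose k) :: complex)" for k
  define L where "L k = fdiff M (h + real k *\<^sub>R u) g x" for k
  define R where "R k = fdiff M (real k *\<^sub>R u) g (x + real k *\<^sub>R h)" for k
  have sgn: "(-1) ^ (M - j) = ((-1) ^ M * (-1) ^ j :: complex)" if "j \<le> M" for j
    using that by (auto simp: minus_one_power_iff)
  have fd: "fdiff M v g z = (-1) ^ M * (\<Sum>j\<le>M. a j * g (z + real j *\<^sub>R v))" for v z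
    unfolding fdiff_def sum_distrib_left by (intro sum.cong) (auto simp: sgn a_def)
  have "(\<Sum>k\<le>M. a k * L k) = (\<Sum>j\<le>M. a j * R j)"
    unfolding L_def R_def fd sum_distrib_left
    by (subst sum.swap) (simp add: algebra_simps)
  moreover have "(\<Sum>k\<le>M. b k) = b 0 + (\<Sum>k=1..M. b k)" for b :: "nat \<Rightarrow> complex"
    by (simp add: atMost_atLeast0 sum.atLeast_Suc_atMost)
  moreover have "a 0 * L 0 = fdiff M h g x"
    by (simp add: a_def L_def)
  moreover have "a 0 * R 0 = 0"
  proof -
    have "(\<Sum>j\<le>M. a j) = 0"
      unfolding a_def using assms choose_alternating_sum[of M, where 'a = complex] by simp
    then show ?thesis
      by (simp add: R_def fd flip: sum_distrib_right)
  qed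
  ultimately have "fdiff M h g x = (\<Sum>k=1..M. a k * R k) - (\<Sum>k=1..M. a k * L k)"
    by (simp add: algebra_simps)
  also have "\<dots> = (\<Sum>k=1..M. a k * (R k - L k))"
    by (simp add: sum_subtractf right_diff_distrib)
  finally show ?thesis
    unfolding a_def R_def L_def .
qed

section \<open>Integrals of powers of differences\<close>

definition pow_int :: "real \<Rightarrow> ('a::euclidean_space \<Rightarrow> complex) \<Rightarrow> ennreal" where
  "pow_int p g = (\<integral>\<^sup>+ x. ennreal (norm (g x) powr p) \<partial>lborel)"

lemma pow_int_translate:
  fixes g :: "'a::euclidean_space \<Rightarrow> complex"
  assumes [measurable]: "g \<in> borel_measurable borel"
  shows "pow_int p (\<lambda>x. g (x + v)) = pow_int p g"
proof -
  have "pow_int p g = (\<integral>\<^sup>+ x. ennreal (norm (g x) powr p) \<partial>distr lborel borel ((+) v))"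
    by (simp add: pow_int_def lborel_distr_plus)
  also have "\<dots> = pow_int p (\<lambda>x. g (x + v))"
    by (subst nn_integral_distr) (auto simp: pow_int_def add.commute)
  finally show ?thesis ..
qed

lemma pow_int_cmult:
  assumes [measurable]: "g \<in> borel_measurable borel"
  shows "pow_int p (\<lambda>x. c * g x) = ennreal (norm c powr p) * pow_int p g"
  unfolding pow_int_def
  by (subst nn_integral_cmult[symmetric]) (auto simp: norm_mult powr_mult ennreal_mult)

lemma pow_int_sum_le:
  assumes [measurable]: "\<And>i. i \<in> I \<Longrightarrow> G i \<in> borel_measurable borel"
    and "finite I" and "0 < p"
  shows "pow_int p (\<lambda>x. \<Sum>i\<in>I. G i x) \<le> ennreal (real (card I) powr p) * (\<Sum>i\<in>I. pow_int p (G i))"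
proof -
  have "pow_int p (\<lambda>x. \<Sum>i\<in>I. G i x)
      \<le> (\<integral>\<^sup>+ x. ennreal (real (card I) powr p) * (\<Sum>i\<in>I. ennreal (norm (G i x) powr p)) \<partial>lborel)"
    unfolding pow_int_def
  proof (rule nn_integral_mono)
    fix x
    have "norm (\<Sum>i\<in>I. G i x) powr p \<le> (\<Sum>i\<in>I. norm (G i x)) powr p"
      using assms by (intro powr_mono2 norm_sum) auto
    also have "\<dots> \<le> real (card I) powr p * (\<Sum>i\<in>I. norm (G i x) powr p)"
      using assms by (intro powr_sum_le) auto
    finally have "ennreal (norm (\<Sum>i\<in>I. G i x) powr p)
        \<le> ennreal (real (card I) powr p * (\<Sum>i\<in>I. norm (G i x) powr p))"
      by (rule ennreal_leI)
    then show "ennreal (norm (\<Sum>i\<in>I. G i x) powr p)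
        \<le> ennreal (real (card I) powr p) * (\<Sum>i\<in>I. ennreal (norm (G i x) powr p))"
      by (simp add: ennreal_mult sum_nonneg)
  qed
  also have "\<dots> = ennreal (real (card I) powr p) * (\<Sum>i\<in>I. pow_int p (G i))"
    unfolding pow_int_def by (subst nn_integral_cmult, measurable) (subst nn_integral_sum, measurable)
  finally show ?thesis .
qed

lemma pow_int_diff_le:
  fixes u v :: "'a::euclidean_space \<Rightarrow> complex"
  assumes [measurable]: "u \<in> borel_measurable borel" "v \<in> borel_measurable borel" and "0 < p"
  shows "pow_int p (\<lambda>x. u x - v x) \<le> ennreal (2 powr p) * (pow_int p u + pow_int p v)"
proof -
  define G where "G i = (if i then u else (\<lambda>x. - v x))" for i
  have [measurable]: "G i \<in> borel_measurable borel" for i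
    by (auto simp: G_def)
  have "pow_int p (\<lambda>x. \<Sum>i\<in>UNIV. G i x) \<le> ennreal (real (card (UNIV :: bool set)) powr p)
      * (\<Sum>i\<in>UNIV. pow_int p (G i))"
    using assms by (intro pow_int_sum_le) auto
  then show ?thesis
    by (simp add: UNIV_bool G_def pow_int_def add.commute)
qed

text \<open>
  In the following estimates the constant is chosen before the function and the step. The uniformity in the
  step is what later allows suprema and averages over steps.
\<close>

lemma pow_int_shift_poly_le:
  assumes "0 < p"
  obtains C where "0 < C" and "\<And>(h::'a::euclidean_space) g. g \<in> borel_measurable borel \<Longrightarrow>
    pow_int p (shift_poly c h g) \<le> ennreal C * pow_int p g"
proof
  define C where "C = real (card {..degree c}) powr p * (\<Sum>i\<le>degree c. norm (coeff c i) powr p)"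
  show "0 < C + 1"
    by (simp add: C_def sum_nonneg add_nonneg_pos)
  fix h :: 'a and g :: "'a \<Rightarrow> complex"
  assume [measurable]: "g \<in> borel_measurable borel"
  have "pow_int p (shift_poly c h g) \<le> ennreal (real (card {..degree c}) powr p) *
      (\<Sum>i\<le>degree c. pow_int p (\<lambda>x. coeff c i * g (x + real i *\<^sub>R h)))"
    unfolding shift_poly_def[abs_def] using assms by (intro pow_int_sum_le) auto
  also have "\<dots> = ennreal C * pow_int p g"
    by (simp add: pow_int_cmult pow_int_translate C_def ennreal_mult sum_nonneg mult.assoc
        flip: sum_distrib_right)
  also have "\<dots> \<le> ennreal (C + 1) * pow_int p g"
    by (intro mult_right_mono ennreal_leI) auto
  finally show "pow_int p (shift_poly c h g) \<le> ennreal (C + 1) * pow_int p g" .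
qed

lemma borel_measurable_shift_poly [measurable]:
  fixes g :: "'a::euclidean_space \<Rightarrow> complex"
  assumes [measurable]: "g \<in> borel_measurable borel"
  shows "shift_poly c h g \<in> borel_measurable borel"
  unfolding shift_poly_def[abs_def] by measurable

lemma borel_measurable_fdiff [measurable]:
  fixes g :: "'a::euclidean_space \<Rightarrow> complex"
  assumes [measurable]: "g \<in> borel_measurable borel"
  shows "fdiff M h g \<in> borel_measurable borel"
  unfolding fdiff_def[abs_def] by measurable

lemma borel_measurable_pow_int_fdiff [measurable]:
  fixes g :: "'a::euclidean_space \<Rightarrow> complex"
  assumes [measurable]: "g \<in> borel_measurable borel"
  shows "(\<lambda>h. pow_int p (fdiff M h g)) \<in> borel_measurable borel"
  unfolding pow_int_def fdiff_def by measurable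

lemma pow_int_fdiff_le:
  assumes "0 < p"
  obtains C where "0 < C" and "\<And>(h::'a::euclidean_space) g. g \<in> borel_measurable borel \<Longrightarrow>
    pow_int p (fdiff M h g) \<le> ennreal C * pow_int p g"
  using pow_int_shift_poly_le[OF assms, of "[:-1, 1:] ^ M", where 'a = 'a] that
  unfolding fdiff_eq_shift_poly by metis

lemma pow_int_fdiff_add_order_le:
  assumes "0 < p"
  obtains C where "0 < C" and "\<And>(h::'a::euclidean_space) g. g \<in> borel_measurable borel \<Longrightarrow>
    pow_int p (fdiff (M + n) h g) \<le> ennreal C * pow_int p (fdiff M h g)"
  using pow_int_shift_poly_le[OF assms, of "[:-1, 1:] ^ n", where 'a = 'a] that
  unfolding fdiff_add_order by (metis borel_measurable_fdiff)

lemma pow_int_fdiff_dilate_le: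
  assumes "0 < p"
  obtains C where "0 < C" and "\<And>(h::'a::euclidean_space) g. g \<in> borel_measurable borel \<Longrightarrow>
    pow_int p (fdiff M (real n *\<^sub>R h) g) \<le> ennreal C * pow_int p (fdiff M h g)"
proof -
  obtain c where "\<forall>(h::'a) g. fdiff M (real n *\<^sub>R h) g = shift_poly c h (fdiff M h g)"
    using fdiff_dilate_factor by blast
  then show ?thesis
    using pow_int_shift_poly_le[OF assms, of c, where 'a = 'a] that
    by (metis borel_measurable_fdiff)
qed

text \<open>
  The factor \<open>2 powr (- M * p)\<close> is the gain from halving the step. It beats the weight
  \<open>2 powr (s * p)\<close> of the smoothness \<open>s\<close> exactly if \<open>s < M\<close>.
\<close>

lemma pow_int_fdiff_marchaud:
  assumes "0 < p" and "1 < l"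
  obtains C where "0 < C" and "\<And>(h::'a::euclidean_space) g. g \<in> borel_measurable borel \<Longrightarrow>
    pow_int p (fdiff M h g) \<le> ennreal (l * 2 powr (- real M * p)) * pow_int p (fdiff M (2 *\<^sub>R h) g)
      + ennreal C * pow_int p (fdiff (Suc M) h g)"
proof -
  obtain c where c: "\<And>(h::'a) g x.
      fdiff M (2 *\<^sub>R h) g x = 2 ^ M * fdiff M h g x + shift_poly c h (fdiff (Suc M) h g) x"
    using fdiff_double by metis
  obtain A where A: "0 < A" "\<And>(h::'a) g. g \<in> borel_measurable borel \<Longrightarrow>
    pow_int p (shift_poly c h g) \<le> ennreal A * pow_int p g"
    using pow_int_shift_poly_le[OF assms(1)] by metis
  obtain B where B: "0 < B"
    "\<And>a b. 0 \<le> a \<Longrightarrow> 0 \<le> b \<Longrightarrow> (a + b) powr p \<le> l * a powr p + B * b powr p"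
    using powr_add_le_eps[OF assms] by metis
  define e where "e = 2 powr (- real M * p)"
  have "pow_int p (fdiff M h g) \<le> ennreal (l * e) * pow_int p (fdiff M (2 *\<^sub>R h) g)
      + ennreal (B * e * A) * pow_int p (fdiff (Suc M) h g)"
    if [measurable]: "g \<in> borel_measurable borel" for h :: 'a and g
  proof -
    let ?u = "fdiff M (2 *\<^sub>R h) g" and ?v = "shift_poly c h (fdiff (Suc M) h g)"
    have ptw: "norm (fdiff M h g x) powr p \<le> l * e * norm (?u x) powr p + B * e * norm (?v x) powr p" for x
    proof -
      have "2 ^ M * norm (fdiff M h g x) = norm (?u x - ?v x)"
        using c[of h g x] by (simp add: norm_mult norm_power)
      then have "norm (fdiff M h g x) = 2 powr (- real M) * norm (?u x - ?v x)"
        by (simp add: powr_minus powr_realpow field_simps)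
      then have "norm (fdiff M h g x) powr p = e * norm (?u x - ?v x) powr p"
        by (simp add: powr_mult powr_powr e_def)
      also have "\<dots> \<le> e * (norm (?u x) + norm (?v x)) powr p"
        using assms by (intro mult_left_mono powr_mono2 norm_triangle_ineq4) (auto simp: e_def)
      also have "\<dots> \<le> e * (l * norm (?u x) powr p + B * norm (?v x) powr p)"
        by (intro mult_left_mono B) (auto simp: e_def)
      finally show ?thesis by (simp add: algebra_simps)
    qed
    have "pow_int p (fdiff M h g) \<le> (\<integral>\<^sup>+ x. ennreal (l * e) * ennreal (norm (?u x) powr p)
        + ennreal (B * e) * ennreal (norm (?v x) powr p) \<partial>lborel)"
      unfolding pow_int_def using assms B(1) ptw
      by (intro nn_integral_mono) (simp add: e_def ennreal_leI flip: ennreal_plus ennreal_mult)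
    also have "\<dots> = ennreal (l * e) * pow_int p ?u + ennreal (B * e) * pow_int p ?v"
      unfolding pow_int_def by (subst nn_integral_add) (auto simp: nn_integral_cmult)
    also have "\<dots> \<le> ennreal (l * e) * pow_int p ?u
        + ennreal (B * e) * (ennreal A * pow_int p (fdiff (Suc M) h g))"
      by (intro add_mono mult_left_mono A) auto
    finally show ?thesis
      using A(1) B(1) by (simp add: ennreal_mult e_def mult.assoc)
  qed
  moreover have "0 < B * e * A"
    using A(1) B(1) by (simp add: e_def)
  ultimately show ?thesis
    using that[of "B * e * A"] unfolding e_def by blast
qed

section \<open>Averaging over the step\<close>

lemma sets_borel_cball [measurable]: "cball a t \<in> sets borel"
  by simp

lemma nn_integral_affine_le:
  fixes G :: "'a::euclidean_space \<Rightarrow> ennreal"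
  assumes [measurable]: "G \<in> borel_measurable borel" and c: "1 \<le> c"
  shows "(\<integral>\<^sup>+ u. G (v + c *\<^sub>R u) \<partial>lborel) \<le> (\<integral>\<^sup>+ u. G u \<partial>lborel)"
proof -
  let ?J = "\<integral>\<^sup>+ u. G (v + c *\<^sub>R u) \<partial>lborel"
  have "1 * ?J \<le> ennreal (\<bar>c\<bar> ^ DIM('a)) * ?J"
    using c by (intro mult_right_mono) (auto simp: one_le_power)
  also have "\<dots> = (\<integral>\<^sup>+ u. G u \<partial>lborel)"
    using c by (subst (2) lborel_affine[of c v])
      (auto simp: nn_integral_density nn_integral_distr nn_integral_cmult)
  finally show ?thesis by simp
qed

lemma pow_int_fdiff_two_steps:
  assumes "0 < p" and "M \<noteq> 0"
  obtains C where "0 < C" and "\<And>(h::'a::euclidean_space) u g. g \<in> borel_measurable borel \<Longrightarrow>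
    pow_int p (fdiff M h g) \<le> ennreal C *
      (\<Sum>k=1..M. pow_int p (fdiff M (real k *\<^sub>R u) g) + pow_int p (fdiff M (h + real k *\<^sub>R u) g))"
proof
  define C where "C = real M powr p * (2 ^ M) powr p * 2 powr p"
  show "0 < C" using assms by (simp add: C_def)
  fix h u :: 'a and g :: "'a \<Rightarrow> complex"
  assume [measurable]: "g \<in> borel_measurable borel"
  let ?P = "\<lambda>v. pow_int p (fdiff M v g)"
  define D where "D k x = fdiff M (real k *\<^sub>R u) g (x + real k *\<^sub>R h) - fdiff M (h + real k *\<^sub>R u) g x" for k x
  have [measurable]: "D k \<in> borel_measurable borel" for k
    unfolding D_def[abs_def] by measurable
  have D: "pow_int p (D k) \<le> ennreal (2 powr p) * (?P (real k *\<^sub>R u) + ?P (h + real k *\<^sub>R u))" for k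
    unfolding D_def[abs_def] using assms
    by (subst pow_int_translate[symmetric, of "fdiff M (real k *\<^sub>R u) g" _ "real k *\<^sub>R h"], measurable)
      (intro pow_int_diff_le, measurable)
  have "?P h = pow_int p (\<lambda>x. \<Sum>k=1..M. (-1) ^ k * of_nat (M choose k) * D k x)"
    unfolding D_def using fdiff_two_steps[OF assms(2), of h g _ u] by presburger
  also have "\<dots> \<le> ennreal (real (card {1..M}) powr p) *
      (\<Sum>k=1..M. pow_int p (\<lambda>x. (-1) ^ k * of_nat (M choose k) * D k x))"
    using assms by (intro pow_int_sum_le) auto
  also have "\<dots> \<le> ennreal (real (card {1..M}) powr p) *
      (\<Sum>k=1..M. ennreal ((2 ^ M) powr p) * (ennreal (2 powr p) * (?P (real k *\<^sub>R u) + ?P (h + real k *\<^sub>R u))))"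
  proof (intro mult_left_mono sum_mono)
    fix k
    have "real (M choose k) \<le> 2 ^ M"
      by (metis binomial_le_pow2 of_nat_le_iff of_nat_numeral of_nat_power)
    then have "norm ((-1) ^ k * of_nat (M choose k) :: complex) powr p \<le> (2 ^ M) powr p"
      using assms by (intro powr_mono2) (auto simp: norm_mult norm_power)
    then have "pow_int p (\<lambda>x. (-1) ^ k * of_nat (M choose k) * D k x)
        \<le> ennreal ((2 ^ M) powr p) * pow_int p (D k)"
      by (subst pow_int_cmult, measurable) (intro mult_right_mono ennreal_leI, auto)
    also have "\<dots> \<le> ennreal ((2 ^ M) powr p) *
        (ennreal (2 powr p) * (?P (real k *\<^sub>R u) + ?P (h + real k *\<^sub>R u)))"
      by (intro mult_left_mono D) auto
    finally show "pow_int p (\<lambda>x. (-1) ^ k * of_nat (M choose k) * D k x) \<le> \<dots>" .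
  qed auto
  also have "\<dots> = ennreal C * (\<Sum>k=1..M. ?P (real k *\<^sub>R u) + ?P (h + real k *\<^sub>R u))"
    by (simp add: C_def ennreal_mult mult.assoc sum_distrib_left)
  finally show "?P h \<le> \<dots>" .
qed

text \<open>
  The power \<open>r\<close> is applied here, before averaging over \<open>u\<close>, so that averaging yields the average of the
  powers, which is the quantity in the Besov seminorm.
\<close>

lemma epowr_pow_int_fdiff_two_steps:
  assumes "0 < p" and "0 < r" and "M \<noteq> 0"
  obtains C where "0 < C" and "\<And>(h::'a::euclidean_space) u g. g \<in> borel_measurable borel \<Longrightarrow>
    epowr (pow_int p (fdiff M h g)) r \<le> ennreal C *
      (\<Sum>k=1..M. epowr (pow_int p (fdiff M (real k *\<^sub>R u) g)) r
        + epowr (pow_int p (fdiff M (h + real k *\<^sub>R u) g)) r)"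
proof -
  obtain A where A: "0 < A" "\<And>(h::'a) u g. g \<in> borel_measurable borel \<Longrightarrow>
    pow_int p (fdiff M h g) \<le> ennreal A *
      (\<Sum>k=1..M. pow_int p (fdiff M (real k *\<^sub>R u) g) + pow_int p (fdiff M (h + real k *\<^sub>R u) g))"
    by (rule pow_int_fdiff_two_steps[OF assms(1,3)]) blast
  obtain B where B: "0 < B"
    "\<And>a b. epowr (a + b) r \<le> ennreal 2 * epowr a r + ennreal B * epowr b r"
    by (rule epowr_add_le_eps[OF assms(2), of 2]) auto
  define E where "E = max 2 B"
  have E: "epowr (a + b) r \<le> ennreal E * (epowr a r + epowr b r)" for a b
  proof -
    have "ennreal 2 * epowr a r + ennreal B * epowr b r \<le> ennreal E * epowr a r + ennreal E * epowr b r"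
      by (intro add_mono mult_right_mono ennreal_leI) (auto simp: E_def)
    then show ?thesis
      using B(2)[of a b] by (simp add: distrib_left)
  qed
  define C where "C = A powr r * (real M powr r * E)"
  show ?thesis
  proof (rule that)
    show "0 < C" using A(1) assms by (simp add: C_def E_def)
    fix h u :: 'a and g :: "'a \<Rightarrow> complex"
    assume g: "g \<in> borel_measurable borel"
    let ?P = "\<lambda>v. pow_int p (fdiff M v g)"
    let ?Q = "\<lambda>v. epowr (pow_int p (fdiff M v g)) r"
    have "?Q h \<le> epowr (ennreal A * (\<Sum>k=1..M. ?P (real k *\<^sub>R u) + ?P (h + real k *\<^sub>R u))) r"
      using A(2)[OF g] assms by (intro epowr_mono) auto
    also have "\<dots> = ennreal (A powr r) * epowr (\<Sum>k=1..M. ?P (real k *\<^sub>R u) + ?P (h + real k *\<^sub>R u)) r"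
      by (rule epowr_cmult) fact
    also have "\<dots> \<le> ennreal (A powr r) * (ennreal (real (card {1..M}) powr r) *
        (\<Sum>k=1..M. epowr (?P (real k *\<^sub>R u) + ?P (h + real k *\<^sub>R u)) r))"
      using assms by (intro mult_left_mono epowr_sum_le) auto
    also have "\<dots> \<le> ennreal (A powr r) * (ennreal (real (card {1..M}) powr r) *
        (\<Sum>k=1..M. ennreal E * (?Q (real k *\<^sub>R u) + ?Q (h + real k *\<^sub>R u))))"
      by (intro mult_left_mono sum_mono E) auto
    also have "\<dots> = ennreal C * (\<Sum>k=1..M. ?Q (real k *\<^sub>R u) + ?Q (h + real k *\<^sub>R u))"
      by (simp add: C_def E_def ennreal_mult mult.assoc sum_distrib_left)
    finally show "?Q h \<le> \<dots>" .
  qed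
qed

text \<open>
  With \<open>h\<close> and \<open>u\<close> in a ball of radius \<open>\<rho>\<close>, the steps \<open>k u\<close> and \<open>h + k u\<close> lie in the ball of
  radius \<open>(M + 1) * \<rho>\<close>. To have the same radius on both sides, the step \<open>h\<close> is first divided by \<open>M + 1\<close>,
  at the cost of a constant.
\<close>

lemma epowr_pow_int_fdiff_average:
  assumes "0 < p" and "0 < r" and "M \<noteq> 0"
  obtains C where "0 < C" and "\<And>(h::'a::euclidean_space) t g. g \<in> borel_measurable borel \<Longrightarrow>
    0 < t \<Longrightarrow> norm h \<le> t \<Longrightarrow> epowr (pow_int p (fdiff M h g)) r \<le> ennreal (C / t ^ DIM('a)) *
      (\<integral>\<^sup>+ w\<in>cball 0 t. epowr (pow_int p (fdiff M w g)) r \<partial>lborel)"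
proof -
  obtain A where A: "0 < A" "\<And>(h::'a) u g. g \<in> borel_measurable borel \<Longrightarrow>
    epowr (pow_int p (fdiff M h g)) r \<le> ennreal A *
      (\<Sum>k=1..M. epowr (pow_int p (fdiff M (real k *\<^sub>R u) g)) r
        + epowr (pow_int p (fdiff M (h + real k *\<^sub>R u) g)) r)"
    by (rule epowr_pow_int_fdiff_two_steps[OF assms]) blast
  obtain F where F: "0 < F" "\<And>(h::'a) g. g \<in> borel_measurable borel \<Longrightarrow>
    pow_int p (fdiff M (real (Suc M) *\<^sub>R h) g) \<le> ennreal F * pow_int p (fdiff M h g)"
    by (rule pow_int_fdiff_dilate_le[OF assms(1)]) blast
  define n where "n = DIM('a)"
  define \<omega> where "\<omega> = unit_ball_vol (real n)"
  have \<omega>: "0 < \<omega>" by (simp add: \<omega>_def)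
  define C where "C = F powr r * (A * (2 * real M) * (real (Suc M) ^ n / \<omega>))"
  show ?thesis
  proof (rule that)
    show "0 < C" using A(1) F(1) \<omega> assms by (simp add: C_def)
    fix h :: 'a and t :: real and g :: "'a \<Rightarrow> complex"
    assume g [measurable]: "g \<in> borel_measurable borel" and t: "0 < t" and h: "norm h \<le> t"
    define Q where "Q v = epowr (pow_int p (fdiff M v g)) r" for v
    have [measurable]: "Q \<in> borel_measurable borel"
      unfolding Q_def[abs_def] by measurable
    let ?I = "\<integral>\<^sup>+ w\<in>cball 0 t. Q w \<partial>lborel"
    define h' where "h' = (1 / real (Suc M)) *\<^sub>R h"
    define t' where "t' = t / real (Suc M)"
    have t': "0 < t'" "t = real (Suc M) * t'" "norm h' \<le> t'"
      using t h by (simp_all add: t'_def h'_def field_simps del: of_nat_Suc)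
    have part: "(\<integral>\<^sup>+ u\<in>cball 0 t'. Q (v + real k *\<^sub>R u) \<partial>lborel) \<le> ?I"
      if k: "k \<in> {1..M}" and v: "norm v \<le> t'" for k v
    proof -
      have "norm (v + real k *\<^sub>R u) \<le> t" if "norm u \<le> t'" for u
      proof -
        have "norm (v + real k *\<^sub>R u) \<le> t' + real k * t'"
          using v that by (intro order_trans[OF norm_triangle_ineq] add_mono) (auto simp: mult_left_mono)
        also have "\<dots> \<le> t' + real M * t'"
          using k t' by (intro add_mono mult_right_mono) auto
        finally show ?thesis
          using t' by (simp add: algebra_simps)
      qed
      then have "(\<integral>\<^sup>+ u\<in>cball 0 t'. Q (v + real k *\<^sub>R u) \<partial>lborel)
          \<le> (\<integral>\<^sup>+ u. Q (v + real k *\<^sub>R u) * indicator (cball 0 t) (v + real k *\<^sub>R u) \<partial>lborel)"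
        by (intro nn_integral_mono) (auto split: split_indicator)
      also have "\<dots> \<le> ?I"
      proof (rule nn_integral_affine_le)
        show "(\<lambda>u. Q u * indicator (cball 0 t) u) \<in> borel_measurable borel"
          by measurable
      qed (use k in auto)
      finally show ?thesis .
    qed
    have "ennreal (\<omega> * t' ^ n) * Q h' = (\<integral>\<^sup>+ u\<in>cball (0::'a) t'. Q h' \<partial>lborel)"
      using t' by (subst nn_integral_cmult_indicator)
        (auto simp: emeasure_cball \<omega>_def n_def mult.commute)
    also have "\<dots> \<le> (\<integral>\<^sup>+ u. ennreal A * (\<Sum>k=1..M. Q (0 + real k *\<^sub>R u) * indicator (cball 0 t') u
        + Q (h' + real k *\<^sub>R u) * indicator (cball 0 t') u) \<partial>lborel)"
      using A(2)[OF g, of h', folded Q_def] by (intro nn_integral_mono) (auto split: split_indicator)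
    also have "\<dots> = ennreal A * (\<Sum>k=1..M. (\<integral>\<^sup>+ u\<in>cball 0 t'. Q (0 + real k *\<^sub>R u) \<partial>lborel)
        + (\<integral>\<^sup>+ u\<in>cball 0 t'. Q (h' + real k *\<^sub>R u) \<partial>lborel))"
      by (simp add: nn_integral_cmult nn_integral_sum nn_integral_add)
    also have "\<dots> \<le> ennreal A * (\<Sum>k=1..M. ?I + ?I)"
      using t' by (intro mult_left_mono sum_mono add_mono part) auto
    also have "\<dots> = ennreal (A * (2 * real M)) * ?I"
      using A(1) by (simp add: ennreal_mult mult.assoc ennreal_of_nat_eq_real_of_nat
        distrib_left mult_2[symmetric] mult.left_commute)
    finally have main: "ennreal (\<omega> * t' ^ n) * Q h' \<le> ennreal (A * (2 * real M)) * ?I" .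
    have "Q h' = ennreal (1 / (\<omega> * t' ^ n)) * (ennreal (\<omega> * t' ^ n) * Q h')"
      using \<omega> t' by (simp add: mult.assoc[symmetric] flip: ennreal_mult)
    also have "\<dots> \<le> ennreal (1 / (\<omega> * t' ^ n)) * (ennreal (A * (2 * real M)) * ?I)"
      using main by (rule mult_left_mono) simp
    finally have Qh': "Q h' \<le> \<dots>" .
    have "Q h \<le> epowr (ennreal F * pow_int p (fdiff M h' g)) r"
      using F(2)[OF g, of h'] assms unfolding Q_def
      by (intro epowr_mono) (auto simp: h'_def simp del: of_nat_Suc)
    also have "\<dots> = ennreal (F powr r) * Q h'"
      unfolding Q_def by (rule epowr_cmult) fact
    also have "\<dots> \<le> ennreal (F powr r) * (ennreal (1 / (\<omega> * t' ^ n)) * (ennreal (A * (2 * real M)) * ?I))"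
      using Qh' by (rule mult_left_mono) simp
    also have "\<dots> = ennreal (F powr r * (1 / (\<omega> * t' ^ n)) * (A * (2 * real M))) * ?I"
      using A(1) \<omega> t'(1) by (simp add: ennreal_cmult_cmult mult.assoc)
    also have "F powr r * (1 / (\<omega> * t' ^ n)) * (A * (2 * real M)) = C / t ^ n"
      using t \<omega> by (simp add: C_def t'_def field_simps del: of_nat_Suc)
    finally show "epowr (pow_int p (fdiff M h g)) r \<le> ennreal (C / t ^ DIM('a)) *
      (\<integral>\<^sup>+ w\<in>cball 0 t. epowr (pow_int p (fdiff M w g)) r \<partial>lborel)"
      by (simp add: n_def Q_def)
  qed
qed

section \<open>The modulus of smoothness\<close>

definition pow_mod :: "real \<Rightarrow> nat \<Rightarrow> ('a::euclidean_space \<Rightarrow> complex) \<Rightarrow> real \<Rightarrow> ennreal" where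
  "pow_mod p M g t = (SUP h\<in>cball 0 t. pow_int p (fdiff M h g))"

lemma pow_int_fdiff_le_pow_mod: "norm h \<le> t \<Longrightarrow> pow_int p (fdiff M h g) \<le> pow_mod p M g t"
  unfolding pow_mod_def by (rule SUP_upper) simp

lemma pow_mod_finite:
  fixes g :: "'a::euclidean_space \<Rightarrow> complex"
  assumes "0 < p" and g: "g \<in> borel_measurable borel" and fin: "pow_int p g < \<infinity>"
  shows "pow_mod p M g t < \<infinity>"
proof -
  obtain C where C: "0 < C" "\<And>(h::'a) g. g \<in> borel_measurable borel \<Longrightarrow>
    pow_int p (fdiff M h g) \<le> ennreal C * pow_int p g"
    by (rule pow_int_fdiff_le[OF assms(1)]) blast
  have "pow_mod p M g t \<le> ennreal C * pow_int p g"
    unfolding pow_mod_def by (rule SUP_least) (rule C(2)[OF g])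
  also have "\<dots> < \<infinity>"
    using fin by (simp add: ennreal_mult_less_top)
  finally show ?thesis .
qed

lemma epowr_pow_mod_le_average:
  assumes "0 < p" and "0 < r" and "M \<noteq> 0"
  obtains C where "0 < C" and "\<And>t (g :: 'a::euclidean_space \<Rightarrow> complex). g \<in> borel_measurable borel \<Longrightarrow>
    0 < t \<Longrightarrow> epowr (pow_mod p M g t) r \<le> ennreal (C / t ^ DIM('a)) *
      (\<integral>\<^sup>+ w\<in>cball 0 t. epowr (pow_int p (fdiff M w g)) r \<partial>lborel)"
proof -
  obtain C where "0 < C" and C: "\<And>(h::'a) t g. g \<in> borel_measurable borel \<Longrightarrow>
    0 < t \<Longrightarrow> norm h \<le> t \<Longrightarrow> epowr (pow_int p (fdiff M h g)) r \<le> ennreal (C / t ^ DIM('a)) *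
      (\<integral>\<^sup>+ w\<in>cball 0 t. epowr (pow_int p (fdiff M w g)) r \<partial>lborel)"
    by (rule epowr_pow_int_fdiff_average[OF assms]) blast
  show ?thesis
  proof (rule that[OF \<open>0 < C\<close>])
    fix t :: real and g :: "'a \<Rightarrow> complex"
    assume "g \<in> borel_measurable borel" "0 < t"
    then show "epowr (pow_mod p M g t) r \<le> ennreal (C / t ^ DIM('a)) *
      (\<integral>\<^sup>+ w\<in>cball 0 t. epowr (pow_int p (fdiff M w g)) r \<partial>lborel)"
      unfolding pow_mod_def using assms by (intro epowr_SUP_le C) auto
  qed
qed

lemma pow_mod_le_average:
  assumes "0 < p" and "M \<noteq> 0"
  obtains C where "0 < C" and "\<And>t (g :: 'a::euclidean_space \<Rightarrow> complex). g \<in> borel_measurable borel \<Longrightarrow>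
    0 < t \<Longrightarrow> pow_mod p M g t \<le> ennreal (C / t ^ DIM('a)) *
      (\<integral>\<^sup>+ w\<in>cball 0 t. pow_int p (fdiff M w g) \<partial>lborel)"
proof (rule epowr_pow_mod_le_average[OF assms(1) zero_less_one assms(2), where 'a = 'a], rule that)
  fix C t :: real and g :: "'a \<Rightarrow> complex"
  assume "\<And>t (g :: 'a::euclidean_space \<Rightarrow> complex). g \<in> borel_measurable borel \<Longrightarrow>
    0 < t \<Longrightarrow> epowr (pow_mod p M g t) 1 \<le> ennreal (C / t ^ DIM('a)) *
      (\<integral>\<^sup>+ w\<in>cball 0 t. epowr (pow_int p (fdiff M w g)) 1 \<partial>lborel)"
    and "g \<in> borel_measurable borel" "0 < t"
  from this(1)[OF this(2,3)] show "pow_mod p M g t \<le> ennreal (C / t ^ DIM('a)) *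
      (\<integral>\<^sup>+ w\<in>cball 0 t. pow_int p (fdiff M w g) \<partial>lborel)"
    by simp
qed

lemma pow_mod_marchaud:
  assumes "0 < p" and "0 < r" and "1 < m"
  obtains C where "0 < C" and "\<And>t (g :: 'a::euclidean_space \<Rightarrow> complex). g \<in> borel_measurable borel \<Longrightarrow>
    epowr (pow_mod p M g (t / 2)) r \<le> ennreal (m * 2 powr (- real M * p * r)) * epowr (pow_mod p M g t) r
      + ennreal C * epowr (pow_mod p (Suc M) g (t / 2)) r"
proof -
  \<comment> \<open>The factor \<open>m\<close> is shared by the two quasi-triangle inequalities, inside the integral and for the power \<open>r\<close>.\<close>
  define l where "l = m powr (1 / (2 * r))"
  define l' where "l' = m powr (1 / 2)"
  have l: "1 < l" "1 < l'" and ll: "l' * l powr r = m"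
    using assms by (auto simp: l_def l'_def powr_powr simp flip: powr_add)
  obtain A where A: "0 < A" "\<And>(h::'a::euclidean_space) g. g \<in> borel_measurable borel \<Longrightarrow>
    pow_int p (fdiff M h g) \<le> ennreal (l * 2 powr (- real M * p)) * pow_int p (fdiff M (2 *\<^sub>R h) g)
      + ennreal A * pow_int p (fdiff (Suc M) h g)"
    by (rule pow_int_fdiff_marchaud[OF assms(1) l(1)]) blast
  obtain B where B: "0 < B"
    "\<And>a b. epowr (a + b) r \<le> ennreal l' * epowr a r + ennreal B * epowr b r"
    by (rule epowr_add_le_eps[OF assms(2) l(2)]) blast
  show ?thesis
  proof (rule that[of "B * A powr r"])
    show "0 < B * A powr r" using A(1) B(1) by simp
    fix t :: real and g :: "'a \<Rightarrow> complex"
    assume g: "g \<in> borel_measurable borel"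
    define c where "c = l * 2 powr (- real M * p)"
    have c: "0 < c" using l by (simp add: c_def)
    have "pow_mod p M g (t / 2) \<le> ennreal c * pow_mod p M g t + ennreal A * pow_mod p (Suc M) g (t / 2)"
      unfolding pow_mod_def[of p M g "t / 2"]
    proof (rule SUP_least)
      fix h :: 'a
      assume "h \<in> cball 0 (t / 2)"
      then have "norm h \<le> t / 2" "norm (2 *\<^sub>R h) \<le> t" by auto
      then have "ennreal c * pow_int p (fdiff M (2 *\<^sub>R h) g) + ennreal A * pow_int p (fdiff (Suc M) h g)
          \<le> ennreal c * pow_mod p M g t + ennreal A * pow_mod p (Suc M) g (t / 2)"
        by (intro add_mono mult_left_mono pow_int_fdiff_le_pow_mod) auto
      with A(2)[OF g, of h] show "pow_int p (fdiff M h g) \<le> \<dots>"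
        unfolding c_def by (rule order_trans)
    qed
    then have "epowr (pow_mod p M g (t / 2)) r
        \<le> epowr (ennreal c * pow_mod p M g t + ennreal A * pow_mod p (Suc M) g (t / 2)) r"
      using assms by (intro epowr_mono) auto
    also have "\<dots> \<le> ennreal l' * epowr (ennreal c * pow_mod p M g t) r
        + ennreal B * epowr (ennreal A * pow_mod p (Suc M) g (t / 2)) r"
      by (rule B(2))
    also have "\<dots> = ennreal (l' * c powr r) * epowr (pow_mod p M g t) r
        + ennreal (B * A powr r) * epowr (pow_mod p (Suc M) g (t / 2)) r"
      using c l A(1) B(1) by (simp add: epowr_cmult ennreal_cmult_cmult)
    also have "l' * c powr r = m * 2 powr (- real M * p * r)"
      using l ll by (simp add: c_def powr_mult powr_powr mult.assoc[symmetric])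
    finally show "epowr (pow_mod p M g (t / 2)) r
        \<le> ennreal (m * 2 powr (- real M * p * r)) * epowr (pow_mod p M g t) r
          + ennreal (B * A powr r) * epowr (pow_mod p (Suc M) g (t / 2)) r" .
  qed
qed

section \<open>Dyadic values of the modulus and the Besov seminorm\<close>

text \<open>
  For \<open>r = q / p\<close> these are the \<open>q\<close>-th powers of the terms \<open>2 powr (j * s) * \<omega> (2 powr - j)\<close>, where
  \<open>\<omega>\<close> is the modulus of smoothness in \<open>L\<^sup>p\<close>. For \<open>r = 1\<close> they are its \<open>p\<close>-th powers.
\<close>

definition dyadic_mod :: "real \<Rightarrow> real \<Rightarrow> real \<Rightarrow> nat \<Rightarrow> ('a::euclidean_space \<Rightarrow> complex) \<Rightarrow> nat \<Rightarrow> ennreal" where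
  "dyadic_mod s p r M g j =
     ennreal (2 powr (real j * (s * p * r))) * epowr (pow_mod p M g (2 powr - real j)) r"

lemma geometric_sum_le:
  fixes x :: real
  assumes "1 < x"
  shows "(\<Sum>j\<le>n. x ^ j) \<le> x / (x - 1) * x ^ n"
proof (induction n)
  case 0
  then show ?case using assms by simp
next
  case (Suc n)
  have "x / (x - 1) * x ^ n + x ^ Suc n = x / (x - 1) * x ^ Suc n"
    using assms by (simp add: field_simps)
  with Suc show ?case by simp
qed

text \<open>
  A geometric series is dominated by its last term, which belongs to the last \<open>j\<close> with
  \<open>x \<le> 2 powr - j\<close>.
\<close>

lemma dyadic_sum_le:
  fixes a x :: real
  assumes "0 < a" and "0 < x"
  shows "(\<Sum>j<n. 2 powr (real j * a) * indicator {..2 powr - real j} x)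
    \<le> 2 powr a / (2 powr a - 1) * x powr - a"
proof (induction n)
  case 0
  then show ?case using assms by (simp add: ge_one_powr_ge_zero)
next
  case (Suc n)
  let ?f = "\<lambda>j. 2 powr (real j * a) * indicator {..2 powr - real j} x"
  show ?case
  proof (cases "x \<le> 2 powr - real n")
    case True
    have "(\<Sum>j<Suc n. ?f j) \<le> (\<Sum>j\<le>n. (2 powr a) ^ j)"
      unfolding lessThan_Suc_atMost
      by (intro sum_mono) (auto simp: powr_powr mult.commute simp flip: powr_realpow split: split_indicator)
    also have "\<dots> \<le> 2 powr a / (2 powr a - 1) * (2 powr a) ^ n"
      using assms by (intro geometric_sum_le) auto
    also have "\<dots> = 2 powr a / (2 powr a - 1) * (2 powr - real n) powr - a"
      by (simp add: powr_powr mult.commute flip: powr_realpow)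
    also have "\<dots> \<le> 2 powr a / (2 powr a - 1) * x powr - a"
      using assms True
      by (intro mult_left_mono powr_mono2' divide_nonneg_nonneg) (auto simp: ge_one_powr_ge_zero)
    finally show ?thesis .
  next
    case False
    then show ?thesis using Suc by simp
  qed
qed

lemma suminf_dyadic_le:
  fixes w :: "'a::euclidean_space"
  assumes "0 < a" and "w \<noteq> 0"
  shows "(\<Sum>j. ennreal (2 powr (real j * a)) * indicator (cball 0 (2 powr - real j)) w)
    \<le> ennreal (2 powr a / (2 powr a - 1) * norm w powr - a)"
proof -
  let ?f = "\<lambda>j. 2 powr (real j * a) * indicator {..2 powr - real j} (norm w)"
  have "(\<Sum>j. ennreal (?f j)) \<le> ennreal (2 powr a / (2 powr a - 1) * norm w powr - a)"
  proof (rule suminf_le_const)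
    fix n
    have "(\<Sum>j<n. ennreal (?f j)) = ennreal (\<Sum>j<n. ?f j)"
      by (simp add: sum_ennreal)
    also have "\<dots> \<le> ennreal (2 powr a / (2 powr a - 1) * norm w powr - a)"
      using assms by (intro ennreal_leI dyadic_sum_le) auto
    finally show "(\<Sum>j<n. ennreal (?f j)) \<le> \<dots>" .
  qed simp
  also have "(\<lambda>j. ennreal (?f j)) = (\<lambda>j. ennreal (2 powr (real j * a)) * indicator (cball 0 (2 powr - real j)) w)"
    by (auto split: split_indicator)
  finally show ?thesis .
qed

text \<open>
  Each modulus is bounded by an average over the ball of radius \<open>2 powr - j\<close>. Exchanging sum and
  integral, the weights of the balls that contain \<open>w\<close> add up to a multiple of
  \<open>norm w powr - (DIM('a) + s * p * r)\<close>.
\<close>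

lemma suminf_dyadic_mod_finite:
  fixes g :: "'a::euclidean_space \<Rightarrow> complex"
  assumes "0 < p" "0 < r" "M \<noteq> 0" "0 < s" and g [measurable]: "g \<in> borel_measurable borel"
    and fin: "(\<integral>\<^sup>+ h\<in>cball 0 1. (epowr (pow_int p (fdiff M h g)) r
      / ennreal (norm h powr (real DIM('a) + s * p * r))) \<partial>lborel) < \<infinity>"
  shows "(\<Sum>j. dyadic_mod s p r M g j) < \<infinity>"
proof -
  obtain C where C: "0 < C" "\<And>t (g :: 'a \<Rightarrow> complex). g \<in> borel_measurable borel \<Longrightarrow>
    0 < t \<Longrightarrow> epowr (pow_mod p M g t) r \<le> ennreal (C / t ^ DIM('a)) *
      (\<integral>\<^sup>+ w\<in>cball 0 t. epowr (pow_int p (fdiff M w g)) r \<partial>lborel)"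
    by (rule epowr_pow_mod_le_average[OF assms(1-3)]) blast
  let ?Q = "\<lambda>w. epowr (pow_int p (fdiff M w g)) r"
  define a where "a = real DIM('a) + s * p * r"
  have a: "0 < a" using assms by (simp add: a_def add_nonneg_pos)
  define A where "A = 2 powr a / (2 powr a - 1)"
  have A: "0 < A" using a by (simp add: A_def)
  have bound: "dyadic_mod s p r M g j
      \<le> (\<integral>\<^sup>+ w. ennreal C * ?Q w * (ennreal (2 powr (real j * a)) * indicator (cball 0 (2 powr - real j)) w) \<partial>lborel)" for j
  proof -
    let ?t = "2 powr - real j"
    have "dyadic_mod s p r M g j \<le> ennreal (2 powr (real j * (s * p * r))) *
        (ennreal (C / ?t ^ DIM('a)) * (\<integral>\<^sup>+ w\<in>cball 0 ?t. ?Q w \<partial>lborel))"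
      unfolding dyadic_mod_def by (intro mult_left_mono C) auto
    also have "\<dots> = ennreal (2 powr (real j * (s * p * r)) * (C / ?t ^ DIM('a))) * (\<integral>\<^sup>+ w\<in>cball 0 ?t. ?Q w \<partial>lborel)"
      using C(1) by (intro ennreal_cmult_cmult) auto
    also have "?t ^ DIM('a) = 2 powr (- (real j * real DIM('a)))"
      by (simp add: powr_powr flip: powr_realpow)
    also have "2 powr (real j * (s * p * r)) * (C / \<dots>) = C * 2 powr (real j * a)"
      by (simp add: a_def powr_minus powr_add algebra_simps divide_inverse)
    also have "ennreal (C * 2 powr (real j * a)) * (\<integral>\<^sup>+ w\<in>cball 0 ?t. ?Q w \<partial>lborel)
        = (\<integral>\<^sup>+ w. ennreal C * ?Q w * (ennreal (2 powr (real j * a)) * indicator (cball 0 ?t) w) \<partial>lborel)"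
      using C(1) by (subst nn_integral_cmult[symmetric], measurable) (simp add: ennreal_mult mult_ac)
    finally show ?thesis .
  qed
  have "(\<Sum>j. dyadic_mod s p r M g j) \<le> (\<Sum>j. \<integral>\<^sup>+ w. ennreal C * ?Q w *
      (ennreal (2 powr (real j * a)) * indicator (cball 0 (2 powr - real j)) w) \<partial>lborel)"
    by (intro suminf_le bound) auto
  also have "\<dots> = (\<integral>\<^sup>+ w. (\<Sum>j. ennreal C * ?Q w *
      (ennreal (2 powr (real j * a)) * indicator (cball 0 (2 powr - real j)) w)) \<partial>lborel)"
    by (rule nn_integral_suminf[symmetric]) measurable
  also have "\<dots> = (\<integral>\<^sup>+ w. ennreal C * ?Q w * (\<Sum>j. ennreal (2 powr (real j * a)) * indicator (cball 0 (2 powr - real j)) w) \<partial>lborel)"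
    by (simp only: ennreal_suminf_cmult)
  also have "\<dots> \<le> (\<integral>\<^sup>+ w. ennreal (C * A) * (?Q w / ennreal (norm w powr a) * indicator (cball 0 1) w) \<partial>lborel)"
  proof (rule nn_integral_mono_AE, rule AE_mp[OF AE_lborel_singleton[of 0]], rule AE_I2, rule impI)
    fix w :: 'a
    assume w: "w \<noteq> 0"
    let ?S = "\<Sum>j. ennreal (2 powr (real j * a)) * indicator (cball 0 (2 powr - real j)) w"
    have "?S \<le> ennreal (A * norm w powr - a) * indicator (cball 0 1) w"
    proof (cases "norm w \<le> 1")
      case True
      then show ?thesis
        using suminf_dyadic_le[OF a w] by (simp add: A_def)
    next
      case False
      have "2 powr - real j \<le> (1::real)" for j
        by (simp add: powr_minus inverse_le_1_iff ge_one_powr_ge_zero)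
      with False have "\<not> norm w \<le> 2 powr - real j" for j
        by (meson order_trans)
      then show ?thesis by simp
    qed
    then have "ennreal C * ?Q w * ?S \<le> ennreal C * ?Q w * (ennreal (A * norm w powr - a) * indicator (cball 0 1) w)"
      by (rule mult_left_mono) simp
    also have "\<dots> = ennreal (C * A) * (?Q w / ennreal (norm w powr a) * indicator (cball 0 1) w)"
      using A C(1) w by (simp add: ennreal_mult divide_ennreal_def powr_minus inverse_ennreal mult_ac)
    finally show "ennreal C * ?Q w * ?S \<le> \<dots>" .
  qed
  also have "\<dots> = ennreal (C * A) * (\<integral>\<^sup>+ w\<in>cball 0 1. (?Q w / ennreal (norm w powr a)) \<partial>lborel)"
    by (rule nn_integral_cmult) measurable
  also have "\<dots> < \<infinity>"
    using fin by (simp add: a_def ennreal_mult_less_top)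
  finally show ?thesis .
qed

lemma SUP_dyadic_mod_finite:
  fixes g :: "'a::euclidean_space \<Rightarrow> complex"
  assumes bound: "\<And>h. 0 < norm h \<Longrightarrow> norm h \<le> 1 \<Longrightarrow>
      pow_int p (fdiff M h g) \<le> ennreal (norm h powr (s * p)) * B"
    and "0 < p" "M \<noteq> 0" "0 < s" and B: "B < \<infinity>"
  shows "(SUP j. dyadic_mod s p 1 M g j) < \<infinity>"
proof -
  have "dyadic_mod s p 1 M g j \<le> B" for j
  proof -
    let ?t = "2 powr - real j :: real"
    have t: "?t \<le> 1"
      by (simp add: powr_minus inverse_le_1_iff ge_one_powr_ge_zero)
    have "pow_int p (fdiff M h g) \<le> ennreal (?t powr (s * p)) * B" if "norm h \<le> ?t" for h
    proof (cases "h = 0")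
      case True
      have "fdiff M 0 g x = 0" for x
        using \<open>M \<noteq> 0\<close> by (rule fdiff_zero)
      then show ?thesis
        by (simp add: True pow_int_def)
    next
      case False
      then have "pow_int p (fdiff M h g) \<le> ennreal (norm h powr (s * p)) * B"
        using that t by (intro bound) auto
      also have "\<dots> \<le> ennreal (?t powr (s * p)) * B"
        using assms that by (intro mult_right_mono ennreal_leI powr_mono2) auto
      finally show ?thesis .
    qed
    then have "pow_mod p M g ?t \<le> ennreal (?t powr (s * p)) * B"
      unfolding pow_mod_def by (intro SUP_least) auto
    then have "dyadic_mod s p 1 M g j \<le> ennreal (2 powr (real j * (s * p))) * (ennreal (?t powr (s * p)) * B)"
      unfolding dyadic_mod_def by (simp add: mult_left_mono)
    also have "\<dots> = ennreal (2 powr (real j * (s * p)) * ?t powr (s * p)) * B"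
      by (rule ennreal_cmult_cmult) auto
    also have "2 powr (real j * (s * p)) * ?t powr (s * p) = 1"
      by (simp add: powr_powr flip: powr_add)
    finally show ?thesis by simp
  qed
  then have "(SUP j. dyadic_mod s p 1 M g j) \<le> B"
    by (rule SUP_least)
  then show ?thesis using B by (rule le_less_trans)
qed

lemma Lp_norm_eq_epowr_pow_int:
  "p < \<infinity> \<Longrightarrow> Lp_norm p u = epowr (pow_int (enn2real p) u) (1 / enn2real p)"
  by (auto simp: Lp_norm_def pow_int_def nn_integral_completion)

lemma epowr_Lp_norm:
  "p < \<infinity> \<Longrightarrow> epowr (Lp_norm p u) a = epowr (pow_int (enn2real p) u) (a / enn2real p)"
  by (simp add: Lp_norm_eq_epowr_pow_int epowr_epowr)

lemma besov_seminorm_imp_dyadic_mod: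
  fixes g :: "'a::euclidean_space \<Rightarrow> complex"
  assumes p: "0 < p" "p < q" and s: "0 < s" and "M \<noteq> 0" and g: "g \<in> borel_measurable borel"
    and fin: "besov_seminorm M s p q g < \<infinity>"
  shows "q < \<infinity> \<Longrightarrow> (\<Sum>j. dyadic_mod s (enn2real p) (enn2real q / enn2real p) M g j) < \<infinity>"
    and "q = \<infinity> \<Longrightarrow> (SUP j. dyadic_mod s (enn2real p) 1 M g j) < \<infinity>"
proof -
  define P where "P = enn2real p"
  have p': "p < \<infinity>" using p(2) by (rule less_le_trans) simp
  then have P: "0 < P"
    using p by (simp add: P_def enn2real_positive_iff)
  show "(\<Sum>j. dyadic_mod s (enn2real p) (enn2real q / enn2real p) M g j) < \<infinity>" if q: "q < \<infinity>"
  proof -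
    define Q where "Q = enn2real q"
    have Q: "0 < Q"
      using p q unfolding Q_def by (simp add: enn2real_positive_iff)
    have "(\<Sum>j. dyadic_mod s P (Q / P) M g j) < \<infinity>"
    proof (rule suminf_dyadic_mod_finite[OF P _ \<open>M \<noteq> 0\<close> s g])
      have "{h :: 'a. norm h \<le> 1} = cball 0 1" by auto
      moreover have "s * P * (Q / P) = s * Q" using P by simp
      moreover have "q \<noteq> top" using q by auto
      ultimately show "(\<integral>\<^sup>+ h\<in>cball 0 1. (epowr (pow_int P (fdiff M h g)) (Q / P)
          / ennreal (norm h powr (real DIM('a) + s * P * (Q / P)))) \<partial>lborel) < \<infinity>"
        using fin
        by (simp add: besov_seminorm_def nn_integral_completion
          epowr_Lp_norm[OF p'] P_def Q_def)
    qed (use P Q in auto)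
    then show ?thesis by (simp add: P_def Q_def)
  qed
  show "(SUP j. dyadic_mod s (enn2real p) 1 M g j) < \<infinity>" if q: "q = \<infinity>"
  proof -
    define B where "B = besov_seminorm M s p q g"
    have "(SUP j. dyadic_mod s P 1 M g j) < \<infinity>"
    proof (rule SUP_dyadic_mod_finite[OF _ P \<open>M \<noteq> 0\<close> s])
      show "epowr B P < \<infinity>"
        using fin by (simp add: B_def)
      fix h :: 'a
      assume h: "0 < norm h" "norm h \<le> 1"
      let ?L = "Lp_norm p (fdiff M h g)"
      have "ennreal (norm h powr (- s)) * ?L \<le> B"
        unfolding B_def besov_seminorm_def using q h
        by (auto intro!: SUP_upper2[of h])
      have "?L = ennreal (norm h powr s) * (ennreal (norm h powr (- s)) * ?L)"
        using h by (subst ennreal_cmult_cmult) (auto simp flip: powr_add)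
      also have "\<dots> \<le> ennreal (norm h powr s) * B"
        by (intro mult_left_mono) (fact, simp)
      finally have "epowr ?L P \<le> epowr (ennreal (norm h powr s) * B) P"
        using P by (intro epowr_mono) auto
      also have "\<dots> = ennreal (norm h powr (s * P)) * epowr B P"
        using h by (subst epowr_cmult) (auto simp: powr_powr)
      finally show "pow_int P (fdiff M h g) \<le> \<dots>"
        using P by (simp add: epowr_Lp_norm[OF p'] P_def)
    qed
    then show ?thesis by (simp add: P_def)
  qed
qed

section \<open>Change of the order of differences\<close>

text \<open>
  The contraction factor is \<open>2 powr (- e / 2)\<close> with \<open>e = (M - s) * p * r > 0\<close>: one half of the
  exponent \<open>e\<close> pays for the factor \<open>l > 1\<close> in the quasi-triangle inequality.
\<close>

lemma dyadic_mod_marchaud: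
  assumes "0 < p" and "0 < r" and "s < real M"
  obtains \<theta> C where "0 < \<theta>" and "\<theta> < 1" and "0 < C"
    and "\<And>j (g :: 'a::euclidean_space \<Rightarrow> complex). g \<in> borel_measurable borel \<Longrightarrow>
      dyadic_mod s p r M g (Suc j) \<le> ennreal \<theta> * dyadic_mod s p r M g j
        + ennreal C * dyadic_mod s p r (Suc M) g (Suc j)"
proof -
  define e where "e = (real M - s) * p * r"
  have e: "0 < e" using assms by (simp add: e_def)
  then have "1 < (2::real) powr (e / 2)" by simp
  then obtain C where C: "0 < C" "\<And>t (g :: 'a \<Rightarrow> complex). g \<in> borel_measurable borel \<Longrightarrow>
    epowr (pow_mod p M g (t / 2)) r
      \<le> ennreal (2 powr (e / 2) * 2 powr (- real M * p * r)) * epowr (pow_mod p M g t) r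
      + ennreal C * epowr (pow_mod p (Suc M) g (t / 2)) r"
    by (rule pow_mod_marchaud[OF assms(1,2)]) blast
  show ?thesis
  proof (rule that[of "2 powr (- e / 2)" C])
    fix j and g :: "'a \<Rightarrow> complex"
    assume g: "g \<in> borel_measurable borel"
    define T where "T = 2 powr - real j"
    have T: "2 powr - real (Suc j) = T / 2"
      by (simp add: T_def powr_diff powr_minus field_simps)
    define w where "w i = 2 powr (real i * (s * p * r))" for i
    have w: "w (Suc j) * (2 powr (e / 2) * 2 powr (- real M * p * r)) = 2 powr (- e / 2) * w j"
      by (simp add: w_def e_def algebra_simps flip: powr_add) (simp add: field_simps)
    have "dyadic_mod s p r M g (Suc j) = ennreal (w (Suc j)) * epowr (pow_mod p M g (T / 2)) r"
      by (simp only: dyadic_mod_def T w_def)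
    also have "\<dots> \<le> ennreal (w (Suc j)) *
        (ennreal (2 powr (e / 2) * 2 powr (- real M * p * r)) * epowr (pow_mod p M g T) r
        + ennreal C * epowr (pow_mod p (Suc M) g (T / 2)) r)"
      by (intro mult_left_mono C(2) g) auto
    also have "\<dots> = ennreal (2 powr (- e / 2) * w j) * epowr (pow_mod p M g T) r
        + ennreal (C * w (Suc j)) * epowr (pow_mod p (Suc M) g (T / 2)) r"
      unfolding distrib_left w[symmetric] mult.commute[of C] using C(1)
      by (intro arg_cong2[where f = "(+)"] ennreal_cmult_cmult) (auto simp: w_def)
    also have "\<dots> = ennreal (2 powr (- e / 2)) * dyadic_mod s p r M g j
        + ennreal C * dyadic_mod s p r (Suc M) g (Suc j)"
      unfolding dyadic_mod_def T T_def[symmetric] w_def[symmetric] using C(1)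
      by (subst (1 2) ennreal_cmult_cmult) (auto simp: w_def)
    finally show "dyadic_mod s p r M g (Suc j) \<le> \<dots>" .
  qed (use e C(1) in \<open>auto simp: powr_less_one\<close>)
qed

text \<open>
  \<open>d / (1 - \<theta>)\<close> is the fixed point of \<open>x \<mapsto> d + \<theta> * x\<close>, hence an invariant bound for the recursions
  below.
\<close>

lemma recursion_step_le:
  fixes \<theta> d :: real
  assumes "0 \<le> \<theta>" "\<theta> < 1" "0 \<le> d" and "x \<le> ennreal (d / (1 - \<theta>))"
  shows "ennreal d + ennreal \<theta> * x \<le> ennreal (d / (1 - \<theta>))"
proof -
  have "ennreal d + ennreal \<theta> * x \<le> ennreal d + ennreal \<theta> * ennreal (d / (1 - \<theta>))"
    using assms by (intro add_mono mult_left_mono) auto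
  also have "\<dots> = ennreal (d + \<theta> * (d / (1 - \<theta>)))"
    using assms by (simp add: ennreal_mult[symmetric])
  also have "d + \<theta> * (d / (1 - \<theta>)) = d / (1 - \<theta>)"
    using assms by (simp add: field_simps)
  finally show ?thesis .
qed

lemma suminf_recursion_finite:
  fixes b c :: "nat \<Rightarrow> ennreal"
  assumes "0 \<le> \<theta>" "\<theta> < 1" and rec: "\<And>j. b (Suc j) \<le> ennreal \<theta> * b j + ennreal C * c (Suc j)"
    and "b 0 < \<infinity>" and "(\<Sum>j. c j) < \<infinity>"
  shows "(\<Sum>j. b j) < \<infinity>"
proof -
  have "b 0 + ennreal C * (\<Sum>j. c j) < \<infinity>"
    using assms by (simp add: ennreal_mult_less_top)
  then obtain d where d: "b 0 + ennreal C * (\<Sum>j. c j) = ennreal d" "0 \<le> d"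
    by (metis ennreal_cases infinity_ennreal_def less_irrefl)
  have "(\<Sum>j<n. b j) \<le> ennreal (d / (1 - \<theta>))" for n
  proof (induction n)
    case 0
    then show ?case by simp
  next
    case (Suc n)
    have "(\<Sum>j<Suc n. b j) = b 0 + (\<Sum>j<n. b (Suc j))"
      by (rule sum.lessThan_Suc_shift)
    also have "\<dots> \<le> b 0 + (\<Sum>j<n. ennreal \<theta> * b j + ennreal C * c (Suc j))"
      by (intro add_left_mono sum_mono rec)
    also have "\<dots> = b 0 + ennreal C * (\<Sum>j<n. c (Suc j)) + ennreal \<theta> * (\<Sum>j<n. b j)"
      by (simp add: sum.distrib sum_distrib_left ac_simps)
    also have "\<dots> \<le> b 0 + ennreal C * (\<Sum>j. c j) + ennreal \<theta> * (\<Sum>j<n. b j)"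
    proof (intro add_mono mult_left_mono)
      have "(\<Sum>j<n. c (Suc j)) \<le> (\<Sum>j<Suc n. c j)"
        by (subst sum.lessThan_Suc_shift) simp
      also have "\<dots> \<le> (\<Sum>j. c j)"
        by (rule sum_le_suminf) auto
      finally show "(\<Sum>j<n. c (Suc j)) \<le> (\<Sum>j. c j)" .
    qed auto
    also have "\<dots> \<le> ennreal (d / (1 - \<theta>))"
      unfolding d(1) using assms d Suc by (intro recursion_step_le) auto
    finally show ?case .
  qed
  then have "(\<Sum>j. b j) \<le> ennreal (d / (1 - \<theta>))"
    by (intro suminf_le_const) auto
  then show ?thesis
    by (rule le_less_trans) simp
qed

lemma SUP_recursion_finite:
  fixes b c :: "nat \<Rightarrow> ennreal"
  assumes "0 \<le> \<theta>" "\<theta> < 1" and rec: "\<And>j. b (Suc j) \<le> ennreal \<theta> * b j + ennreal C * c (Suc j)"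
    and "b 0 < \<infinity>" and "(SUP j. c j) < \<infinity>"
  shows "(SUP j. b j) < \<infinity>"
proof -
  have "b 0 + ennreal C * (SUP j. c j) < \<infinity>"
    using assms by (simp add: ennreal_mult_less_top)
  then obtain d where d: "b 0 + ennreal C * (SUP j. c j) = ennreal d" "0 \<le> d"
    by (metis ennreal_cases infinity_ennreal_def less_irrefl)
  have "b n \<le> ennreal (d / (1 - \<theta>))" for n
  proof (induction n)
    case 0
    have "b 0 \<le> ennreal d"
      unfolding d(1)[symmetric] by simp
    also have "\<dots> \<le> ennreal d + ennreal \<theta> * 0"
      by simp
    also have "\<dots> \<le> ennreal (d / (1 - \<theta>))"
      using assms d by (intro recursion_step_le) auto
    finally show ?case .
  next
    case (Suc n)
    have "b (Suc n) \<le> ennreal \<theta> * b n + ennreal C * c (Suc n)"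
      by (rule rec)
    also have "\<dots> \<le> (b 0 + ennreal C * (SUP j. c j)) + ennreal \<theta> * b n"
      by (subst add.commute, intro add_mono add_increasing mult_left_mono SUP_upper) auto
    also have "\<dots> \<le> ennreal (d / (1 - \<theta>))"
      unfolding d(1) using assms d Suc by (intro recursion_step_le) auto
    finally show ?case .
  qed
  then have "(SUP j. b j) \<le> ennreal (d / (1 - \<theta>))"
    by (rule SUP_least)
  then show ?thesis
    by (rule le_less_trans) simp
qed

lemma dyadic_mod_add_order_le:
  assumes "0 < p" and "0 < r"
  obtains C where "0 < C" and "\<And>j (g :: 'a::euclidean_space \<Rightarrow> complex). g \<in> borel_measurable borel \<Longrightarrow>
    dyadic_mod s p r (M + n) g j \<le> ennreal C * dyadic_mod s p r M g j"
proof -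
  obtain A where A: "0 < A" "\<And>(h::'a) g. g \<in> borel_measurable borel \<Longrightarrow>
    pow_int p (fdiff (M + n) h g) \<le> ennreal A * pow_int p (fdiff M h g)"
    by (rule pow_int_fdiff_add_order_le[OF assms(1)]) blast
  show ?thesis
  proof (rule that[of "A powr r"])
    show "0 < A powr r" using A(1) by simp
    fix j and g :: "'a \<Rightarrow> complex"
    assume g: "g \<in> borel_measurable borel"
    let ?t = "2 powr - real j"
    have "pow_mod p (M + n) g ?t \<le> ennreal A * pow_mod p M g ?t"
      unfolding pow_mod_def[of p "M + n"]
    proof (rule SUP_least)
      fix h :: 'a assume "h \<in> cball 0 ?t"
      then have "ennreal A * pow_int p (fdiff M h g) \<le> ennreal A * pow_mod p M g ?t"
        by (intro mult_left_mono pow_int_fdiff_le_pow_mod) auto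
      with A(2)[OF g, of h] show "pow_int p (fdiff (M + n) h g) \<le> \<dots>"
        by (rule order_trans)
    qed
    then have "epowr (pow_mod p (M + n) g ?t) r \<le> epowr (ennreal A * pow_mod p M g ?t) r"
      using assms by (intro epowr_mono) auto
    also have "\<dots> = ennreal (A powr r) * epowr (pow_mod p M g ?t) r"
      by (rule epowr_cmult) fact
    finally show "dyadic_mod s p r (M + n) g j \<le> ennreal (A powr r) * dyadic_mod s p r M g j"
      unfolding dyadic_mod_def by (subst mult.left_commute) (rule mult_left_mono, auto)
  qed
qed

text \<open>
  This is the independence of the Besov scale of the order of differences, for summable (\<open>q < \<infinity>\<close>)
  and for bounded (\<open>q = \<infinity>\<close>) dyadic sequences. Orders are lowered one at a time, and every
  intermediate order exceeds \<open>s\<close>.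
\<close>

lemma dyadic_mod_change_order:
  fixes g :: "'a::euclidean_space \<Rightarrow> complex"
  assumes "0 < p" and "0 < r" and "s < real K"
    and g: "g \<in> borel_measurable borel" and fin: "pow_int p g < \<infinity>"
  shows "(\<Sum>j. dyadic_mod s p r M g j) < \<infinity> \<Longrightarrow> (\<Sum>j. dyadic_mod s p r K g j) < \<infinity>"
    and "(SUP j. dyadic_mod s p r M g j) < \<infinity> \<Longrightarrow> (SUP j. dyadic_mod s p r K g j) < \<infinity>"
proof -
  let ?S = "\<lambda>M. (\<Sum>j. dyadic_mod s p r M g j) < \<infinity>"
  let ?U = "\<lambda>M. (SUP j. dyadic_mod s p r M g j) < \<infinity>"
  have down: "(?S (Suc L) \<longrightarrow> ?S L) \<and> (?U (Suc L) \<longrightarrow> ?U L)" if L: "s < real L" for L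
  proof -
    obtain \<theta> C where \<theta>: "0 < \<theta>" "\<theta> < 1" and
      rec: "\<And>j (g :: 'a \<Rightarrow> complex). g \<in> borel_measurable borel \<Longrightarrow>
      dyadic_mod s p r L g (Suc j) \<le> ennreal \<theta> * dyadic_mod s p r L g j
        + ennreal C * dyadic_mod s p r (Suc L) g (Suc j)"
      by (rule dyadic_mod_marchaud[OF assms(1,2) L]) blast
    have "dyadic_mod s p r L g 0 < \<infinity>"
      using pow_mod_finite[OF assms(1) g fin] by (simp add: dyadic_mod_def)
    then show ?thesis
      using suminf_recursion_finite[where b = "dyadic_mod s p r L g" and c = "dyadic_mod s p r (Suc L) g", OF _ \<theta>(2) rec[OF g]]
        SUP_recursion_finite[where b = "dyadic_mod s p r L g" and c = "dyadic_mod s p r (Suc L) g", OF _ \<theta>(2) rec[OF g]]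
        \<theta>(1) by simp
  qed
  have down': "(?S (K + n) \<longrightarrow> ?S K) \<and> (?U (K + n) \<longrightarrow> ?U K)" for n
  proof (induction n)
    case (Suc n)
    with down[of "K + n"] assms(3) show ?case by auto
  qed simp
  have up: "(?S M \<longrightarrow> ?S (M + n)) \<and> (?U M \<longrightarrow> ?U (M + n))" for n
  proof -
    obtain C where C: "\<And>j (g :: 'a \<Rightarrow> complex). g \<in> borel_measurable borel \<Longrightarrow>
      dyadic_mod s p r (M + n) g j \<le> ennreal C * dyadic_mod s p r M g j"
      by (rule dyadic_mod_add_order_le[OF assms(1,2)]) blast
    have "(\<Sum>j. dyadic_mod s p r (M + n) g j) \<le> ennreal C * (\<Sum>j. dyadic_mod s p r M g j)"
      unfolding ennreal_suminf_cmult[symmetric] by (intro suminf_le C g) auto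
    moreover have "(SUP j. dyadic_mod s p r (M + n) g j) \<le> ennreal C * (SUP j. dyadic_mod s p r M g j)"
      by (rule SUP_least, rule order_trans[OF C[OF g]]) (intro mult_left_mono SUP_upper, auto)
    ultimately show ?thesis
      by (auto intro: le_less_trans simp: ennreal_mult_less_top)
  qed
  have "(?S M \<longrightarrow> ?S K) \<and> (?U M \<longrightarrow> ?U K)"
  proof (cases "M \<le> K")
    case True
    then show ?thesis using up[of "K - M"] by simp
  next
    case False
    then show ?thesis using down'[of "M - K"] by simp
  qed
  then show "?S M \<Longrightarrow> ?S K" and "?U M \<Longrightarrow> ?U K" by auto
qed

section \<open>Weights in the dual sequence space\<close>

text \<open>
  Young's inequality without the optimal constants: compare \<open>y\<close> with \<open>x powr (1 / (r - 1))\<close>.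
\<close>

lemma mult_le_powr_add_powr:
  fixes x y r :: real
  assumes "0 \<le> x" "0 \<le> y" "1 < r"
  shows "x * y \<le> x powr (r / (r - 1)) + y powr r"
proof (cases "x = 0 \<or> y = 0")
  case False
  with assms have xy: "0 < x" "0 < y" by auto
  show ?thesis
  proof (cases "y \<le> x powr (1 / (r - 1))")
    case True
    then have "x * y \<le> x powr 1 * x powr (1 / (r - 1))"
      using xy by (simp add: mult_left_mono)
    also have "\<dots> = x powr (r / (r - 1))"
    proof -
      have "1 + 1 / (r - 1) = r / (r - 1)"
        using assms by (simp add: field_simps)
      then show ?thesis
        by (simp only: powr_add[symmetric])
    qed
    finally show ?thesis
      using powr_ge_zero[of y r] by linarith
  next
    case False
    then have "x = (x powr (1 / (r - 1))) powr (r - 1)"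
      using assms xy by (simp add: powr_powr)
    also have "\<dots> \<le> y powr (r - 1)"
      using False assms by (intro powr_mono2) auto
    finally have "x * y \<le> y powr (r - 1) * y powr 1"
      using xy by (simp add: mult_right_mono)
    also have "\<dots> = y powr r"
      by (simp only: powr_add[symmetric] diff_add_cancel)
    finally show ?thesis
      using powr_ge_zero[of x "r / (r - 1)"] by linarith
  qed
qed auto

lemma ennreal_mult_le_epowr:
  assumes "0 \<le> x" and "1 < r"
  shows "ennreal x * y \<le> ennreal (x powr (r / (r - 1))) + epowr y r"
proof (cases y)
  case (real z)
  then show ?thesis
    using assms mult_le_powr_add_powr[OF assms(1), of z r]
    by (simp add: epowr_ennreal ennreal_leI flip: ennreal_mult ennreal_plus)
qed simp

lemma suminf_weighted_dyadic_finite: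
  fixes \<Phi> :: "nat \<Rightarrow> real" and g :: "'a::euclidean_space \<Rightarrow> complex"
  assumes r: "1 < r"
    and sum: "summable (\<lambda>j. \<Phi> j powr (p * (r / (r - 1))))"
    and fin: "(\<Sum>j. dyadic_mod s p r M g j) < \<infinity>"
  shows "(\<Sum>j. ennreal (\<Phi> j powr p) * dyadic_mod s p 1 M g j) < \<infinity>"
proof -
  have "(\<Sum>j. ennreal (\<Phi> j powr p) * dyadic_mod s p 1 M g j)
      \<le> (\<Sum>j. ennreal (\<Phi> j powr (p * (r / (r - 1)))) + dyadic_mod s p r M g j)"
  proof (intro suminf_le)
    fix j
    have "epowr (dyadic_mod s p 1 M g j) r = dyadic_mod s p r M g j"
      by (simp add: dyadic_mod_def epowr_cmult powr_powr mult.assoc)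
    then show "ennreal (\<Phi> j powr p) * dyadic_mod s p 1 M g j
        \<le> ennreal (\<Phi> j powr (p * (r / (r - 1)))) + dyadic_mod s p r M g j"
      using ennreal_mult_le_epowr[OF _ r, of "\<Phi> j powr p" "dyadic_mod s p 1 M g j"]
      by (simp add: powr_powr)
  qed auto
  also have "\<dots> = (\<Sum>j. ennreal (\<Phi> j powr (p * (r / (r - 1))))) + (\<Sum>j. dyadic_mod s p r M g j)"
    by (rule suminf_add[symmetric]) auto
  also have "\<dots> < \<infinity>"
    using fin ennreal_suminf_neq_top[OF sum powr_ge_zero, THEN less_top[THEN iffD1]] by simp
  finally show ?thesis .
qed

lemma suminf_weighted_dyadic_finite_sup:
  fixes \<Phi> :: "nat \<Rightarrow> real" and g :: "'a::euclidean_space \<Rightarrow> complex"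
  assumes sum: "summable (\<lambda>j. \<Phi> j powr p)"
    and fin: "(SUP j. dyadic_mod s p 1 M g j) < \<infinity>"
  shows "(\<Sum>j. ennreal (\<Phi> j powr p) * dyadic_mod s p 1 M g j) < \<infinity>"
proof -
  define B where "B = (SUP j. dyadic_mod s p 1 M g j)"
  have B: "dyadic_mod s p 1 M g j \<le> B" for j
    unfolding B_def by (rule SUP_upper) simp
  have sum': "(\<Sum>j. ennreal (\<Phi> j powr p)) < top"
    using ennreal_suminf_neq_top[OF sum powr_ge_zero] by (rule less_top[THEN iffD1])
  have "(\<Sum>j. ennreal (\<Phi> j powr p) * dyadic_mod s p 1 M g j)
      \<le> (\<Sum>j. ennreal (\<Phi> j powr p) * B)"
    by (intro suminf_le mult_left_mono B) auto
  also have "\<dots> = (\<Sum>j. ennreal (\<Phi> j powr p)) * B"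
    by (rule ennreal_suminf_multc)
  also have "\<dots> < \<infinity>"
    using fin sum' by (simp add: B_def ennreal_mult_less_top)
  finally show ?thesis .
qed

section \<open>Slices\<close>

lemma fdiff_slice: "fdiff M v (\<lambda>x. f (x, y)) x = fdiff M (v, 0) f (x, y)"
  by (simp add: fdiff_def)

lemma borel_measurable_slice:
  fixes f :: "'a::euclidean_space \<times> 'b::euclidean_space \<Rightarrow> complex"
  assumes [measurable]: "f \<in> borel_measurable borel"
  shows "(\<lambda>x. f (x, y)) \<in> borel_measurable borel"
  by measurable

text \<open>
  Tonelli's theorem turns the integral over \<open>y\<close> of the slice differences with step \<open>v\<close> into the integral
  of the difference of \<open>f\<close> itself with step \<open>(v, 0)\<close>.
\<close>

lemma nn_integral_slice_average_le:
  fixes f :: "'a::euclidean_space \<times> 'b::euclidean_space \<Rightarrow> complex"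
  assumes f [measurable]: "f \<in> borel_measurable borel" and "0 < t"
  shows "(\<integral>\<^sup>+ y. (\<integral>\<^sup>+ v\<in>cball 0 t. pow_int p (fdiff M v (\<lambda>x. f (x, y))) \<partial>lborel) \<partial>lborel)
    \<le> ennreal (unit_ball_vol (real DIM('a)) * t ^ DIM('a)) * pow_mod p M f t"
proof -
  let ?G = "\<lambda>v y x. ennreal (norm (fdiff M (v, 0) f (x, y)) powr p)"
  have "(\<integral>\<^sup>+ y. (\<integral>\<^sup>+ v\<in>cball 0 t. pow_int p (fdiff M v (\<lambda>x. f (x, y))) \<partial>lborel) \<partial>lborel)
      = (\<integral>\<^sup>+ y. \<integral>\<^sup>+ v. (\<integral>\<^sup>+ x. ?G v y x \<partial>lborel) * indicator (cball 0 t) v \<partial>lborel \<partial>lborel)"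
    by (simp add: pow_int_def fdiff_slice)
  also have "\<dots> = (\<integral>\<^sup>+ v. \<integral>\<^sup>+ y. (\<integral>\<^sup>+ x. ?G v y x \<partial>lborel) * indicator (cball 0 t) v \<partial>lborel \<partial>lborel)"
    unfolding fdiff_def by (rule lborel_pair.Fubini') measurable
  also have "\<dots> = (\<integral>\<^sup>+ v. (\<integral>\<^sup>+ y. \<integral>\<^sup>+ x. ?G v y x \<partial>lborel \<partial>lborel) * indicator (cball 0 t) v \<partial>lborel)"
    unfolding fdiff_def by (intro nn_integral_cong nn_integral_multc) measurable
  also have "\<dots> = (\<integral>\<^sup>+ v\<in>cball 0 t. pow_int p (fdiff M (v, 0) f) \<partial>lborel)"
  proof -
    have "(\<integral>\<^sup>+ y. \<integral>\<^sup>+ x. ?G v y x \<partial>lborel \<partial>lborel) = pow_int p (fdiff M (v, 0) f)" for v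
    proof -
      have "(\<lambda>z. ennreal (norm (fdiff M (v, 0) f z) powr p)) \<in> borel_measurable (lborel \<Otimes>\<^sub>M lborel)"
        unfolding lborel_prod by measurable
      from lborel_pair.nn_integral_snd[OF this] show ?thesis
        by (simp add: pow_int_def lborel_prod)
    qed
    then show ?thesis by simp
  qed
  also have "\<dots> \<le> (\<integral>\<^sup>+ v\<in>cball (0::'a) t. pow_mod p M f t \<partial>lborel)"
    by (intro nn_integral_mono) (auto simp: norm_Pair intro: pow_int_fdiff_le_pow_mod split: split_indicator)
  also have "\<dots> = ennreal (unit_ball_vol (real DIM('a)) * t ^ DIM('a)) * pow_mod p M f t"
    using \<open>0 < t\<close> by (subst nn_integral_cmult_indicator) (auto simp: emeasure_cball mult.commute)
  finally show ?thesis .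
qed

text \<open>
  The moduli of the slices are replaced by averages over steps, which are measurable in \<open>y\<close> and
  have integrals bounded by the moduli of \<open>f\<close>.
\<close>

lemma AE_slice_suminf_finite:
  fixes f :: "'a::euclidean_space \<times> 'b::euclidean_space \<Rightarrow> complex"
  assumes "0 < p" and "M \<noteq> 0" and f [measurable]: "f \<in> borel_measurable borel"
    and fin: "(\<Sum>j. ennreal (a j) * dyadic_mod s p 1 M f j) < \<infinity>"
  shows "AE y in lborel. (\<Sum>j. ennreal (a j) * dyadic_mod s p 1 M (\<lambda>x. f (x, y)) j) < \<infinity>"
proof -
  obtain C where C: "0 < C" "\<And>t (g :: 'a \<Rightarrow> complex). g \<in> borel_measurable borel \<Longrightarrow>
    0 < t \<Longrightarrow> pow_mod p M g t \<le> ennreal (C / t ^ DIM('a)) *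
      (\<integral>\<^sup>+ w\<in>cball 0 t. pow_int p (fdiff M w g) \<partial>lborel)"
    by (rule pow_mod_le_average[OF assms(1,2)]) blast
  define w where "w j = 2 powr (real j * (s * p))" for j
  define T where "T j = 2 powr - real j" for j
  \<comment> \<open>\<open>F\<close> is a measurable majorant in \<open>y\<close> of the weighted sum for the slices.\<close>
  define I where "I j y = (\<integral>\<^sup>+ v\<in>cball 0 (T j). pow_int p (fdiff M v (\<lambda>x. f (x, y))) \<partial>lborel)" for j y
  define F where "F y = (\<Sum>j. ennreal (a j) * (ennreal (w j) * (ennreal (C / T j ^ DIM('a)) * I j y)))" for y
  have [measurable]: "I j \<in> borel_measurable borel" for j
    unfolding I_def[abs_def] pow_int_def fdiff_def by measurable
  have [measurable]: "F \<in> borel_measurable borel"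
    unfolding F_def[abs_def] by measurable
  have T: "0 < T j" for j by (simp add: T_def)
  have dyadic: "dyadic_mod s p 1 M g j = ennreal (w j) * pow_mod p M g (T j)"
    for g :: "'c::euclidean_space \<Rightarrow> complex" and j
    by (simp add: dyadic_mod_def w_def T_def)
  define \<omega> where "\<omega> = unit_ball_vol (real DIM('a))"
  have "(\<integral>\<^sup>+ y. F y \<partial>lborel)
      = (\<Sum>j. \<integral>\<^sup>+ y. ennreal (a j) * (ennreal (w j) * (ennreal (C / T j ^ DIM('a)) * I j y)) \<partial>lborel)"
    unfolding F_def by (rule nn_integral_suminf) measurable
  also have "\<dots> = (\<Sum>j. ennreal (a j) * (ennreal (w j) * (ennreal (C / T j ^ DIM('a)) * (\<integral>\<^sup>+ y. I j y \<partial>lborel))))"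
    by (simp add: nn_integral_cmult)
  also have "\<dots> \<le> (\<Sum>j. ennreal (C * \<omega>) * (ennreal (a j) * dyadic_mod s p 1 M f j))"
  proof (intro suminf_le)
    fix j
    have "(\<integral>\<^sup>+ y. I j y \<partial>lborel) \<le> ennreal (\<omega> * T j ^ DIM('a)) * pow_mod p M f (T j)"
      unfolding I_def \<omega>_def using T by (intro nn_integral_slice_average_le) auto
    then have "ennreal (C / T j ^ DIM('a)) * (\<integral>\<^sup>+ y. I j y \<partial>lborel)
        \<le> ennreal (C / T j ^ DIM('a)) * (ennreal (\<omega> * T j ^ DIM('a)) * pow_mod p M f (T j))"
      by (rule mult_left_mono) simp
    also have "\<dots> = ennreal (C / T j ^ DIM('a) * (\<omega> * T j ^ DIM('a))) * pow_mod p M f (T j)"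
      using C(1) T[of j] by (intro ennreal_cmult_cmult) (auto simp: \<omega>_def)
    also have "C / T j ^ DIM('a) * (\<omega> * T j ^ DIM('a)) = C * \<omega>"
      using T[of j] by simp
    finally have "ennreal (a j) * (ennreal (w j) * (ennreal (C / T j ^ DIM('a)) * (\<integral>\<^sup>+ y. I j y \<partial>lborel)))
        \<le> ennreal (a j) * (ennreal (w j) * (ennreal (C * \<omega>) * pow_mod p M f (T j)))"
      by (intro mult_left_mono) auto
    then show "ennreal (a j) * (ennreal (w j) * (ennreal (C / T j ^ DIM('a)) * (\<integral>\<^sup>+ y. I j y \<partial>lborel)))
        \<le> ennreal (C * \<omega>) * (ennreal (a j) * dyadic_mod s p 1 M f j)"
      by (simp add: dyadic mult_ac)
  qed auto
  also have "\<dots> = ennreal (C * \<omega>) * (\<Sum>j. ennreal (a j) * dyadic_mod s p 1 M f j)"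
    by (rule ennreal_suminf_cmult)
  also have "\<dots> < \<infinity>"
    using fin by (simp add: ennreal_mult_less_top)
  finally have "(\<integral>\<^sup>+ y. F y \<partial>lborel) \<noteq> \<infinity>" by simp
  then have "AE y in lborel. F y \<noteq> \<infinity>"
    by (intro nn_integral_PInf_AE) auto
  then show ?thesis
  proof (rule AE_mp, intro AE_I2 impI)
    fix y
    assume "F y \<noteq> \<infinity>"
    have "pow_mod p M (\<lambda>x. f (x, y)) (T j) \<le> ennreal (C / T j ^ DIM('a)) * I j y" for j
      using C(2)[OF _ T, of "\<lambda>x. f (x, y)"] by (simp add: I_def)
    then have "(\<Sum>j. ennreal (a j) * dyadic_mod s p 1 M (\<lambda>x. f (x, y)) j) \<le> F y"
      unfolding F_def dyadic by (intro suminf_le mult_left_mono) auto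
    also have "\<dots> < \<infinity>"
      using \<open>F y \<noteq> \<infinity>\<close> by (simp add: less_top)
    finally show "(\<Sum>j. ennreal (a j) * dyadic_mod s p 1 M (\<lambda>x. f (x, y)) j) < \<infinity>" .
  qed
qed

lemma AE_slice_pow_int_finite:
  fixes g :: "'a::euclidean_space \<times> 'b::euclidean_space \<Rightarrow> complex"
  assumes [measurable]: "g \<in> borel_measurable borel" and fin: "pow_int p g < \<infinity>"
  shows "AE y in lborel. pow_int p (\<lambda>x. g (x, y)) < \<infinity>"
proof -
  have "(\<integral>\<^sup>+ y. pow_int p (\<lambda>x. g (x, y)) \<partial>lborel) = pow_int p g"
  proof -
    have "(\<lambda>z. ennreal (norm (g z) powr p)) \<in> borel_measurable (lborel \<Otimes>\<^sub>M lborel)"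
      unfolding lborel_prod by measurable
    from lborel_pair.nn_integral_snd[OF this] show ?thesis
      by (simp add: pow_int_def lborel_prod)
  qed
  then have "AE y in lborel. pow_int p (\<lambda>x. g (x, y)) \<noteq> \<infinity>"
    using fin by (intro nn_integral_PInf_AE) (auto simp: pow_int_def)
  then show ?thesis
    by eventually_elim (simp add: less_top)
qed

text \<open>
  The null set is sliced in the second variable, hence the swap of the factors.
\<close>

lemma AE_slice:
  assumes "AE z in (lborel :: ('a::euclidean_space \<times> 'b::euclidean_space) measure). Q z"
  shows "AE y in lborel. AE x in lborel. Q (x, y)"
proof -
  have "AE z in lborel \<Otimes>\<^sub>M lborel. Q z"
    unfolding lborel_prod by (rule assms)
  then have "AE z in distr (lborel \<Otimes>\<^sub>M lborel) (lborel \<Otimes>\<^sub>M lborel) (\<lambda>(y, x). (x, y)). Q z"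
    unfolding lborel_pair.distr_pair_swap[symmetric] .
  then have "AE z in lborel \<Otimes>\<^sub>M lborel. Q (case z of (y, x) \<Rightarrow> (x, y))"
    by (rule AE_distrD[rotated]) simp
  then show ?thesis
    by (auto dest: lborel_pair.AE_pair)
qed

section \<open>From weighted dyadic sums to generalized smoothness\<close>

lemma ex_dyadic_interval:
  fixes t :: real
  assumes "0 < t" "t \<le> 1"
  obtains j where "2 powr - real (Suc j) < t" "t \<le> 2 powr - real j"
proof -
  define j where "j = nat \<lfloor>- log 2 t\<rfloor>"
  have "0 \<le> - log 2 t" using assms by simp
  then have j: "real j \<le> - log 2 t" "- log 2 t < real (Suc j)"
    unfolding j_def by linarith+
  have "t = 2 powr log 2 t" using assms by simp
  moreover have "2 powr - real (Suc j) < 2 powr log 2 t" "2 powr log 2 t \<le> 2 powr - real j"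
    using j by auto
  ultimately show ?thesis using that by metis
qed

text \<open>
  Whether \<open>\<Psi>\<close> increases or decreases, one of the two endpoints dominates.
\<close>

lemma admissible_dyadic_bound:
  assumes adm: "admissible \<Psi>" and t: "2 powr - real (Suc j) < t" "t \<le> 2 powr - real j"
  shows "\<Psi> t \<le> max (\<Psi> (2 powr - real j)) (\<Psi> (2 powr - real (Suc j)))"
proof -
  have "2 powr - real j \<le> (1 :: real)"
    by (simp add: powr_minus inverse_le_1_iff ge_one_powr_ge_zero)
  then have mem: "2 powr - real (Suc j) \<in> {0<..1::real}" "t \<in> {0<..1}" "2 powr - real j \<in> {0<..1::real}"
    using t by (auto intro: less_trans[OF _ t(1)])
  from adm consider "mono_on {0<..1} \<Psi>" | "antimono_on {0<..1} \<Psi>"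
    by (auto simp: admissible_def)
  then show ?thesis
  proof cases
    case 1
    then have "\<Psi> t \<le> \<Psi> (2 powr - real j)"
      using mem(2,3) t(2) by (rule monotone_onD)
    then show ?thesis by simp
  next
    case 2
    then have "\<Psi> t \<le> \<Psi> (2 powr - real (Suc j))"
      using mem(1,2) less_imp_le[OF t(1)] by (rule monotone_onD)
    then show ?thesis by simp
  qed
qed

text \<open>
  Replacing \<open>\<Psi>\<close> by its bound \<open>\<Phi> j\<close> on the dyadic interval from \<open>2 powr - (j + 1)\<close> to \<open>2 powr - j\<close>
  turns the generalized seminorm into a sum over \<open>j\<close>, to be compared with the \<open>\<ell>\<^sup>1\<close> quantity \<open>S\<close>.
\<close>

context
  fixes p q :: ennreal and s :: real and K :: nat and \<Psi> :: "real \<Rightarrow> real" and \<Phi> :: "nat \<Rightarrow> real"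
    and g :: "'a::euclidean_space \<Rightarrow> complex" and P :: real and S :: ennreal
  assumes p: "0 < p" "p < \<infinity>" and s: "0 < s"
    and \<Psi>: "\<And>t. 0 < t \<Longrightarrow> t \<le> 1 \<Longrightarrow> 0 < \<Psi> t"
    and \<Phi>: "\<And>j t. 2 powr - real (Suc j) < t \<Longrightarrow> t \<le> 2 powr - real j \<Longrightarrow> \<Psi> t \<le> \<Phi> j"
    and \<Phi>_pos: "\<And>j. 0 < \<Phi> j"
  defines "P \<equiv> enn2real p"
  defines "S \<equiv> (\<Sum>j. ennreal (\<Phi> j powr P) * dyadic_mod s P 1 K g j)"
  assumes fin: "S < \<infinity>"
begin

lemma P_pos: "0 < P"
  using p by (simp add: P_def enn2real_positive_iff)

lemma weighted_mod_eq: "ennreal (\<Phi> j powr P) * dyadic_mod s P 1 K g j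
    = ennreal (\<Phi> j powr P * 2 powr (real j * (s * P))) * pow_mod P K g (2 powr - real j)"
  by (simp add: dyadic_mod_def ennreal_cmult_cmult)

lemma weighted_mod_le: "ennreal (\<Phi> j powr P) * dyadic_mod s P 1 K g j \<le> S"
proof -
  have "(\<Sum>i\<in>{j}. ennreal (\<Phi> i powr P) * dyadic_mod s P 1 K g i) \<le> S"
    unfolding S_def by (rule sum_le_suminf) auto
  then show ?thesis by simp
qed

lemma epowr_weighted_mod: "epowr (ennreal (\<Phi> j powr P) * dyadic_mod s P 1 K g j) a
    = ennreal (\<Phi> j powr (P * a) * 2 powr (real j * (s * P) * a)) * epowr (pow_mod P K g (2 powr - real j)) a"
  unfolding weighted_mod_eq using \<Phi>_pos[of j]
  by (subst epowr_cmult) (auto simp: powr_mult powr_powr)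

lemma SUP_epowr_Lp_norm_le:
  assumes "0 < a" "t \<le> 2 powr - real j"
  shows "(SUP h\<in>{h. norm h \<le> t}. epowr (Lp_norm p (fdiff K h g)) a)
    \<le> epowr (pow_mod P K g (2 powr - real j)) (a / P)"
proof (rule SUP_least)
  fix h :: 'a
  assume "h \<in> {h. norm h \<le> t}"
  then show "epowr (Lp_norm p (fdiff K h g)) a \<le> epowr (pow_mod P K g (2 powr - real j)) (a / P)"
    unfolding epowr_Lp_norm[OF p(2)] P_def[symmetric] using assms P_pos
    by (intro epowr_mono pow_int_fdiff_le_pow_mod) auto
qed

lemma gen_besov_seminorm_top_finite: "gen_besov_seminorm K s \<Psi> p \<infinity> g < \<infinity>"
proof -
  have "ennreal (t powr (- s) * \<Psi> t) * (SUP h\<in>{h. norm h \<le> t}. Lp_norm p (fdiff K h g))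
      \<le> ennreal (2 powr s) * epowr S (1 / P)" if t: "t \<in> {0<..1}" for t
  proof -
    obtain j where j: "2 powr - real (Suc j) < t" "t \<le> 2 powr - real j"
      using t ex_dyadic_interval[of t] by auto
    have "t powr - s \<le> (2 powr - real (Suc j)) powr - s"
      using j s by (intro powr_mono2') auto
    also have "\<dots> = 2 powr s * 2 powr (real j * s)"
      by (simp add: powr_powr algebra_simps flip: powr_add)
    finally have "t powr (- s) * \<Psi> t \<le> 2 powr s * 2 powr (real j * s) * \<Phi> j"
      using \<Phi>[OF j] \<Psi>[of t] t by (intro mult_mono) auto
    then have "ennreal (t powr (- s) * \<Psi> t) * (SUP h\<in>{h. norm h \<le> t}. Lp_norm p (fdiff K h g))
        \<le> ennreal (2 powr s * 2 powr (real j * s) * \<Phi> j) * epowr (pow_mod P K g (2 powr - real j)) (1 / P)"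
      using SUP_epowr_Lp_norm_le[OF zero_less_one j(2)] by (intro mult_mono[OF ennreal_leI]) auto
    also have "\<dots> = ennreal (2 powr s) * epowr (ennreal (\<Phi> j powr P) * dyadic_mod s P 1 K g j) (1 / P)"
      unfolding epowr_weighted_mod using P_pos \<Phi>_pos[of j]
      by (subst ennreal_cmult_cmult) (auto simp: mult_ac)
    also have "\<dots> \<le> ennreal (2 powr s) * epowr S (1 / P)"
      using P_pos by (intro mult_left_mono epowr_mono weighted_mod_le) auto
    finally show ?thesis .
  qed
  then have "gen_besov_seminorm K s \<Psi> p \<infinity> g \<le> ennreal (2 powr s) * epowr S (1 / P)"
    by (auto simp: gen_besov_seminorm_def intro!: SUP_least)
  also have "\<dots> < \<infinity>"
    using fin by (simp add: ennreal_mult_less_top)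
  finally show ?thesis .
qed

lemma gen_besov_seminorm_finite:
  assumes q: "p < q" "q < \<infinity>"
  shows "gen_besov_seminorm K s \<Psi> p q g < \<infinity>"
proof -
  define Q where "Q = enn2real q"
  have Q: "P < Q"
    using p q unfolding P_def Q_def by (intro enn2real_less_iff[THEN iffD2]) (auto simp: less_top)
  define r where "r = Q / P"
  have r: "1 < r" "P * r = Q"
    using Q P_pos by (auto simp: r_def)
  define z where "z j = ennreal (\<Phi> j powr P) * dyadic_mod s P 1 K g j" for j
  \<comment> \<open>\<open>b j\<close> bounds the integrand on \<open>A j\<close>; the power of \<open>t\<close> is evaluated at the left endpoint.\<close>
  define b where "b j = ennreal (2 powr (real (Suc j) * (1 + s * Q)) * \<Phi> j powr Q)
    * epowr (pow_mod P K g (2 powr - real j)) r" for j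
  define A where "A j = {2 powr - real (Suc j)<..2 powr - real j :: real}" for j
  have "(\<integral>\<^sup>+ t\<in>{0<..1}. ((SUP h\<in>{h. norm h \<le> t}. epowr (Lp_norm p (fdiff K h g)) Q)
      * ennreal (\<Psi> t powr Q / t powr (1 + s * Q))) \<partial>lborel) \<le> (\<integral>\<^sup>+ t. (\<Sum>j. b j * indicator (A j) t) \<partial>lborel)"
  proof (rule nn_integral_mono)
    fix t :: real
    let ?L = "(SUP h\<in>{h. norm h \<le> t}. epowr (Lp_norm p (fdiff K h g)) Q)
      * ennreal (\<Psi> t powr Q / t powr (1 + s * Q))"
    show "?L * indicator {0<..1} t \<le> (\<Sum>j. b j * indicator (A j) t)"
    proof (cases "t \<in> {0<..1}")
      case True
      then obtain j where j: "2 powr - real (Suc j) < t" "t \<le> 2 powr - real j"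
        using ex_dyadic_interval[of t] by auto
      have "\<Psi> t powr Q / t powr (1 + s * Q) = t powr - (1 + s * Q) * \<Psi> t powr Q"
        by (simp only: powr_minus divide_inverse mult.commute)
      also have "\<dots> \<le> (2 powr - real (Suc j)) powr - (1 + s * Q) * \<Phi> j powr Q"
      proof (rule mult_mono[OF powr_mono2' powr_mono2])
        have "0 \<le> s * Q" using s Q P_pos by simp
        then show "- (1 + s * Q) \<le> 0" by simp
      qed (use j Q P_pos \<Phi>[OF j] \<Psi>[of t] True in auto)
      also have "(2 powr - real (Suc j)) powr - (1 + s * Q) = 2 powr (real (Suc j) * (1 + s * Q))"
        unfolding powr_powr by (simp only: minus_mult_minus)
      finally have "?L \<le> epowr (pow_mod P K g (2 powr - real j)) r *
          ennreal (2 powr (real (Suc j) * (1 + s * Q)) * \<Phi> j powr Q)"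
        unfolding r_def using Q P_pos
        by (intro mult_mono SUP_epowr_Lp_norm_le j(2) ennreal_leI) auto
      also have "\<dots> = (\<Sum>i\<in>{j}. b i * indicator (A i) t)"
        using j by (simp add: b_def A_def mult.commute)
      also have "\<dots> \<le> (\<Sum>i. b i * indicator (A i) t)"
        by (rule sum_le_suminf) auto
      finally show ?thesis
        using True by simp
    qed simp
  qed
  also have "\<dots> = (\<Sum>j. \<integral>\<^sup>+ t. b j * indicator (A j) t \<partial>lborel)"
    by (rule nn_integral_suminf) (simp add: A_def)
  also have "\<dots> = (\<Sum>j. ennreal (2 powr (s * Q)) * epowr (z j) r)"
  proof (rule suminf_cong)
    fix j
    have len: "2 powr - real j - 2 powr - real (Suc j) = (2 powr - real (Suc j) :: real)"
      by (simp add: powr_diff powr_minus field_simps)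
    have "(\<integral>\<^sup>+ t. b j * indicator (A j) t \<partial>lborel) = b j * emeasure lborel (A j)"
      by (rule nn_integral_cmult_indicator) (simp add: A_def)
    also have "emeasure lborel (A j) = ennreal (2 powr - real (Suc j))"
      unfolding A_def by (subst emeasure_lborel_Ioc) (simp, simp only: len)
    also have "b j * \<dots> = ennreal (2 powr - real (Suc j) * (2 powr (real (Suc j) * (1 + s * Q)) * \<Phi> j powr Q))
        * epowr (pow_mod P K g (2 powr - real j)) r"
      unfolding b_def by (subst mult.commute) (rule ennreal_cmult_cmult, auto)
    also have "2 powr - real (Suc j) * (2 powr (real (Suc j) * (1 + s * Q)) * \<Phi> j powr Q)
        = 2 powr (s * Q) * (\<Phi> j powr Q * 2 powr (real j * (s * Q)))"
      by (simp add: algebra_simps flip: powr_add)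
    also have "ennreal \<dots> * epowr (pow_mod P K g (2 powr - real j)) r = ennreal (2 powr (s * Q)) * epowr (z j) r"
      unfolding z_def epowr_weighted_mod
      by (subst ennreal_cmult_cmult) (auto simp: r(2)[symmetric] mult.assoc)
    finally show "(\<integral>\<^sup>+ t. b j * indicator (A j) t \<partial>lborel) = ennreal (2 powr (s * Q)) * epowr (z j) r" .
  qed
  also have "\<dots> \<le> (\<Sum>j. ennreal (2 powr (s * Q)) * (epowr S (r - 1) * z j))"
    unfolding z_def by (intro suminf_le mult_left_mono epowr_le_mult r weighted_mod_le) auto
  also have "\<dots> = ennreal (2 powr (s * Q)) * (epowr S (r - 1) * S)"
    by (simp only: ennreal_suminf_cmult S_def z_def)
  also have "\<dots> < \<infinity>"
    using fin by (simp add: ennreal_mult_less_top)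
  finally show ?thesis
    using q by (auto simp: gen_besov_seminorm_def nn_integral_completion Q_def)
qed

end

section \<open>Borel representatives\<close>

text \<open>
  Slices and differences of Borel functions are jointly Borel measurable, so the estimates are carried out for a
  Borel representative.
\<close>

lemma ex_borel_representative:
  fixes f :: "'a::euclidean_space \<Rightarrow> complex"
  assumes "f \<in> borel_measurable lebesgue"
  obtains g where "g \<in> borel_measurable borel" and "AE x in lborel. f x = g x"
proof -
  obtain u where u: "u \<in> borel_measurable lborel" "AE x in lborel. Re (f x) = u x"
    using completion_ex_borel_measurable_real[of "\<lambda>x. Re (f x)" lborel] assms by auto
  obtain v where v: "v \<in> borel_measurable lborel" "AE x in lborel. Im (f x) = v x"
    using completion_ex_borel_measurable_real[of "\<lambda>x. Im (f x)" lborel] assms by auto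
  show ?thesis
  proof (rule that[of "\<lambda>x. Complex (u x) (v x)"])
    show "(\<lambda>x. Complex (u x) (v x)) \<in> borel_measurable borel"
      using u(1) v(1) by (simp add: complex_eq[symmetric] borel_measurable_complex_iff)
    show "AE x in lborel. f x = Complex (u x) (v x)"
      using u(2) v(2) by eventually_elim (simp add: complex_eq_iff)
  qed
qed

lemma borel_measurable_lebesgue_AE:
  fixes f g :: "'a::euclidean_space \<Rightarrow> complex"
  assumes g: "g \<in> borel_measurable borel" and ae: "AE x in lborel. f x = g x"
  shows "f \<in> borel_measurable lebesgue"
proof (rule measurableI)
  fix A :: "complex set"
  assume "A \<in> sets borel"
  then have A: "g -` A \<inter> space lebesgue \<in> sets lebesgue"
    using measurable_completion[of g lborel borel] g by (auto dest: measurable_sets)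
  have "AE x in lebesgue. x \<in> g -` A \<inter> space lebesgue \<longleftrightarrow> x \<in> f -` A \<inter> space lebesgue"
    using ae by (intro AE_completion) auto
  then show "f -` A \<inter> space lebesgue \<in> sets lebesgue"
    by (rule completion.in_sets_AE[OF _ A]) auto
qed simp

lemma pow_int_cong_AE: "AE x in lborel. u x = v x \<Longrightarrow> pow_int p u = pow_int p v"
  unfolding pow_int_def by (rule nn_integral_cong_AE) auto

lemma AE_fdiff_cong:
  fixes f g :: "'a::euclidean_space \<Rightarrow> complex"
  assumes "AE x in lborel. f x = g x"
  shows "AE x in lborel. fdiff M h f x = fdiff M h g x"
proof -
  have "AE x in lborel. f (x + real j *\<^sub>R h) = g (x + real j *\<^sub>R h)" for j
  proof -
    have "AE x in distr lborel borel ((+) (real j *\<^sub>R h)). f x = g x"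
      unfolding lborel_distr_plus by (rule assms)
    then have "AE x in lborel. f (real j *\<^sub>R h + x) = g (real j *\<^sub>R h + x)"
      by (rule AE_distrD[rotated]) simp
    then show ?thesis by (simp add: add.commute)
  qed
  then have "AE x in lborel. \<forall>j. f (x + real j *\<^sub>R h) = g (x + real j *\<^sub>R h)"
    by (simp add: AE_all_countable)
  then show ?thesis
    by eventually_elim (simp add: fdiff_def)
qed

lemma Lp_norm_fdiff_cong_AE:
  assumes "p < \<infinity>" and "AE x in lborel. f x = g x"
  shows "Lp_norm p (fdiff M h f) = Lp_norm p (fdiff M h g)"
  unfolding Lp_norm_eq_epowr_pow_int[OF assms(1)]
  using pow_int_cong_AE[OF AE_fdiff_cong[OF assms(2)]] by metis

lemma gen_besov_seminorm_cong_AE: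
  assumes "p < \<infinity>" and "AE x in lborel. f x = g x"
  shows "gen_besov_seminorm M s \<Psi> p q f = gen_besov_seminorm M s \<Psi> p q g"
  unfolding gen_besov_seminorm_def by (simp only: Lp_norm_fdiff_cong_AE[OF assms])

lemma besov_seminorm_cong_AE:
  assumes "p < \<infinity>" and "AE x in lborel. f x = g x"
  shows "besov_seminorm M s p q f = besov_seminorm M s p q g"
  unfolding besov_seminorm_def by (simp only: Lp_norm_fdiff_cong_AE[OF assms])

section \<open>Slices of Besov functions\<close>

text \<open>
  The number \<open>\<kappa> = chi_index p q\<close> is \<open>p\<close> times the dual exponent of \<open>r = q / p\<close>. For \<open>q = \<infinity>\<close> the
  dual exponent is \<open>1\<close>. As \<open>\<Psi>\<close> enters at both ends of each dyadic interval, \<open>\<Phi>\<close> is the maximum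
  over these ends.
\<close>

lemma AE_slice_gen_besov_seminorm_finite:
  fixes g :: "'a::euclidean_space \<times> 'b::euclidean_space \<Rightarrow> complex"
  assumes p: "0 < p" "p < q" and s: "0 < s" "s < real M" "s < real K"
    and adm: "admissible \<Psi>"
    and sum: "summable (\<lambda>j::nat. \<Psi> (2 powr (- real j)) powr chi_index p q)"
    and g: "g \<in> borel_measurable borel" and Lp: "pow_int (enn2real p) g < \<infinity>"
    and fin: "besov_seminorm M s p q g < \<infinity>"
  shows "AE y in lborel. gen_besov_seminorm K s \<Psi> p q (\<lambda>x. g (x, y)) < \<infinity>"
proof -
  define P where "P = enn2real p"
  have p': "p < \<infinity>" using p(2) by (rule less_le_trans) simp
  then have P: "0 < P"
    using p by (simp add: P_def enn2real_positive_iff)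
  have MK: "M \<noteq> 0" "K \<noteq> 0" using s by auto
  define \<kappa> where "\<kappa> = chi_index p q"
  define \<Phi> where "\<Phi> j = max (\<Psi> (2 powr - real j)) (\<Psi> (2 powr - real (Suc j)))" for j
  have \<Psi>: "0 < \<Psi> t" if "0 < t" "t \<le> 1" for t
    using adm that by (auto simp: admissible_def)
  have \<Psi>j: "0 < \<Psi> (2 powr - real j)" for j
    by (rule \<Psi>) (auto simp: powr_minus inverse_le_1_iff ge_one_powr_ge_zero)
  have \<Phi>_pos: "0 < \<Phi> j" for j
    using \<Psi>j[of j] by (simp add: \<Phi>_def less_max_iff_disj)
  have sum\<Phi>: "summable (\<lambda>j. \<Phi> j powr \<kappa>)"
  proof (rule summable_comparison_test')
    show "summable (\<lambda>j. \<Psi> (2 powr - real j) powr \<kappa> + \<Psi> (2 powr - real (Suc j)) powr \<kappa>)"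
      using sum unfolding \<kappa>_def by (intro summable_add) (simp, subst summable_Suc_iff)
    show "norm (\<Phi> j powr \<kappa>) \<le> \<Psi> (2 powr - real j) powr \<kappa> + \<Psi> (2 powr - real (Suc j)) powr \<kappa>" for j
      by (simp add: \<Phi>_def max_def)
  qed
  have wsum: "(\<Sum>j. ennreal (\<Phi> j powr P) * dyadic_mod s P 1 K g j) < \<infinity>"
  proof (cases "q = \<infinity>")
    case True
    have "(SUP j. dyadic_mod s P 1 M g j) < \<infinity>"
      unfolding P_def by (rule besov_seminorm_imp_dyadic_mod(2)[OF p s(1) MK(1) g fin True])
    then have "(SUP j. dyadic_mod s P 1 K g j) < \<infinity>"
      by (rule dyadic_mod_change_order(2)[OF P zero_less_one s(3) g Lp[folded P_def]])
    moreover have "\<kappa> = P"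
      using True by (simp add: \<kappa>_def chi_index_def P_def)
    ultimately show ?thesis
      using suminf_weighted_dyadic_finite_sup sum\<Phi> by metis
  next
    case False
    then have q: "q < \<infinity>" by (simp add: less_top)
    define Q where "Q = enn2real q"
    have Q: "P < Q"
      using p q p' unfolding P_def Q_def by (intro enn2real_less_iff[THEN iffD2]) (auto simp: less_top)
    define r where "r = Q / P"
    have r: "1 < r" using Q P by (simp add: r_def)
    have "(\<Sum>j. dyadic_mod s P r M g j) < \<infinity>"
      unfolding P_def r_def Q_def by (rule besov_seminorm_imp_dyadic_mod(1)[OF p s(1) MK(1) g fin q])
    then have "(\<Sum>j. dyadic_mod s P r K g j) < \<infinity>"
      using r by (intro dyadic_mod_change_order(1)[OF P _ s(3) g Lp[folded P_def]]) auto
    moreover have "P * (r / (r - 1)) = \<kappa>"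
      using P Q False by (simp add: \<kappa>_def chi_index_def P_def[symmetric] Q_def[symmetric] r_def field_simps)
    ultimately show ?thesis
      using sum\<Phi> by (intro suminf_weighted_dyadic_finite[OF r]) auto
  qed
  have "AE y in lborel. (\<Sum>j. ennreal (\<Phi> j powr P) * dyadic_mod s P 1 K (\<lambda>x. g (x, y)) j) < \<infinity>"
    by (rule AE_slice_suminf_finite[OF P MK(2) g wsum])
  then show ?thesis
  proof eventually_elim
    fix y
    assume y: "(\<Sum>j. ennreal (\<Phi> j powr P) * dyadic_mod s P 1 K (\<lambda>x. g (x, y)) j) < \<infinity>"
    have \<Phi>: "\<Psi> t \<le> \<Phi> j" if "2 powr - real (Suc j) < t" "t \<le> 2 powr - real j" for j t
      unfolding \<Phi>_def by (rule admissible_dyadic_bound[OF adm that])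
    show "gen_besov_seminorm K s \<Psi> p q (\<lambda>x. g (x, y)) < \<infinity>"
    proof (cases "q = \<infinity>")
      case True
      show ?thesis
        unfolding True
        by (rule gen_besov_seminorm_top_finite[OF p(1) p' s(1) \<Psi> \<Phi> \<Phi>_pos y[unfolded P_def]])
    next
      case False
      then have q: "q < \<infinity>" by (simp add: less_top)
      show ?thesis
        by (rule gen_besov_seminorm_finite[OF p(1) p' s(1) \<Psi> \<Phi> \<Phi>_pos y[unfolded P_def] p(2) q])
    qed
  qed
qed

theorem theorem1p6:
  fixes N d M K :: nat and p q :: ennreal and s :: real
    and \<Psi> :: "real \<Rightarrow> real"
    and f :: "(real ^ 'd) \<times> (real ^ 'e) \<Rightarrow> complex"
  assumes "2 \<le> N" and "1 \<le> d" and "d < N"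
    and "CARD('d) = d" and "CARD('e) = N - d"
    and "0 < p" and "p < q" and "q \<le> \<infinity>"
    and "s > sigma_index N p"
    and "real M > s" and "real K > s"
    and "admissible \<Psi>"
    and "summable (\<lambda>j::nat. \<Psi> (2 powr (- real j)) powr chi_index p q)"
    and "f \<in> besov_space M s p q"
  shows "AE y in lebesgue. (\<lambda>x. f (x, y)) \<in> gen_besov_space K s \<Psi> p q"
proof -
  have p: "p < \<infinity>"
    using \<open>p < q\<close> by (rule less_le_trans) simp
  have P: "0 < enn2real p"
    using \<open>0 < p\<close> p by (simp add: enn2real_positive_iff)
  have "0 \<le> sigma_index N p"
    by (simp add: sigma_index_def)
  with \<open>s > sigma_index N p\<close> have s: "0 < s" by simp
  have f: "f \<in> borel_measurable lebesgue" "Lp_norm p f < \<infinity>" "besov_seminorm M s p q f < \<infinity>"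
    using \<open>f \<in> besov_space M s p q\<close> by (auto simp: besov_space_def Lp_space_def)
  obtain g where g: "g \<in> borel_measurable borel" and fg: "AE z in lborel. f z = g z"
    using ex_borel_representative[OF f(1)] .
  have Lp: "pow_int (enn2real p) g < \<infinity>"
    using f(2) pow_int_cong_AE[OF fg] by (simp add: Lp_norm_eq_epowr_pow_int[OF p])
  have "besov_seminorm M s p q g < \<infinity>"
    using f(3) besov_seminorm_cong_AE[OF p fg] by simp
  with assms s g Lp have "AE y in lborel. gen_besov_seminorm K s \<Psi> p q (\<lambda>x. g (x, y)) < \<infinity>"
    by (intro AE_slice_gen_besov_seminorm_finite)
  moreover have "AE y in lborel. pow_int (enn2real p) (\<lambda>x. g (x, y)) < \<infinity>"
    by (rule AE_slice_pow_int_finite[OF g Lp])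
  moreover have "AE y in lborel. AE x in lborel. f (x, y) = g (x, y)"
    by (rule AE_slice[OF fg])
  ultimately have "AE y in lborel. (\<lambda>x. f (x, y)) \<in> gen_besov_space K s \<Psi> p q"
  proof eventually_elim
    fix y
    assume semi: "gen_besov_seminorm K s \<Psi> p q (\<lambda>x. g (x, y)) < \<infinity>"
      and Lp_y: "pow_int (enn2real p) (\<lambda>x. g (x, y)) < \<infinity>"
      and ae: "AE x in lborel. f (x, y) = g (x, y)"
    have "(\<lambda>x. f (x, y)) \<in> borel_measurable lebesgue"
      by (rule borel_measurable_lebesgue_AE[OF borel_measurable_slice[OF g] ae])
    moreover have "Lp_norm p (\<lambda>x. f (x, y)) < \<infinity>"
      using Lp_y pow_int_cong_AE[OF ae] by (simp add: Lp_norm_eq_epowr_pow_int[OF p])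
    moreover have "gen_besov_seminorm K s \<Psi> p q (\<lambda>x. f (x, y)) < \<infinity>"
      using semi gen_besov_seminorm_cong_AE[OF p ae] by simp
    ultimately show "(\<lambda>x. f (x, y)) \<in> gen_besov_space K s \<Psi> p q"
      by (simp add: gen_besov_space_def Lp_space_def)
  qed
  then show ?thesis
    by (rule AE_completion)
qed

end
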